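(* For every $\alpha\in[0,\infty]$, $$\dim_{\rm H}\{x\in(0,1):\lambda(x)=\alpha\}=\dim_{\rm H}\{x\in(0,1):\lambda(x)\ge\alpha\}=\begin{cases}1-\alpha, & 0\le\alpha\le1,\\ 0,& 1<\alpha\le\infty,\end{cases}$$ where $\lambda(x)$ denotes the exponent of convergence of the sequence of Engel digits of $x$.
   Context: Engel series: let $T:[0,1)\to[0,1)$ be defined by $T(0)=0$ and $T(x)=x\lceil 1/x\rceil-1$ for $x\in(0,1)$, where $\lceil y\rceil$ is the least integer not less than $y$. For $x\in(0,1)$ put $d_1(x)=\lceil 1/x\rceil$ and $d_{n+1}(x)=d_1(T^n(x))$ for $n\ge1$, as long as $T^n(x)\neq0$; these positive integers are the digits of the Engel expansion $x=\frac1{d_1(x)}+\frac1{d_1(x)d_2(x)}+\cdots$. If $T^k(x)=0$ for some $k$, the digit sequence is finite (this happens exactly when $x$ is rational); otherwise it is infinite. Exponent of convergence: for $x\in(0,1)$, $\lambda(x)=\inf\{s\ge0:\sum_{n\ge1}d_n(x)^{-s}<\infty\}\in[0,\infty]$, the sum being over all digits of $x$ and $\inf\emptyset=\infty$. In particular $\lambda(x)=0$ if $x$ is rational. $\dim_{\rm H}$ denotes Hausdorff dimension. *)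

theory Defs
  imports "HOL-Analysis.Analysis"
begin

(* The s-th power of the diameter of a covering set. The cases s = 0 and U = {} are
   separate because 0 powr 0 = 0 in Isabelle/HOL, whereas here the 0-th power is 1 for
   every nonempty set, singletons included. *)
definition diam_powr :: "real \<Rightarrow> 'a::metric_space set \<Rightarrow> ennreal" where
  "diam_powr s U =
     (if U = {} then 0 else if s = 0 then 1 else ennreal (diameter U powr s))"

(* Boundedness is required explicitly: diameter is unspecified on unbounded sets. Finite
   covers are included, since the U i may be empty. *)
definition delta_covers :: "real \<Rightarrow> 'a::metric_space set \<Rightarrow> (nat \<Rightarrow> 'a set) set" where
  "delta_covers \<delta> A =
     {U. A \<subseteq> (\<Union>i. U i) \<and> (\<forall>i. bounded (U i) \<and> diameter (U i) \<le> \<delta>)}"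

definition hausdorff_premeasure :: "real \<Rightarrow> real \<Rightarrow> 'a::metric_space set \<Rightarrow> ennreal" where
  "hausdorff_premeasure s \<delta> A = (INF U \<in> delta_covers \<delta> A. \<Sum>i. diam_powr s (U i))"

definition hausdorff_measure :: "real \<Rightarrow> 'a::metric_space set \<Rightarrow> ennreal" where
  "hausdorff_measure s A = (SUP \<delta> \<in> {0<..}. hausdorff_premeasure s \<delta> A)"

definition hausdorff_dim :: "'a::metric_space set \<Rightarrow> ennreal" where
  "hausdorff_dim A = (INF s \<in> {s. 0 \<le> s \<and> hausdorff_measure s A = 0}. ennreal s)"

(* Meant for arguments in [0,1), which it maps to [0,1). *)
definition engel_map :: "real \<Rightarrow> real" where
  "engel_map x = (if x = 0 then 0 else x * of_int \<lceil>1 / x\<rceil> - 1)"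

(* The digits are indexed from 1; the value is a digit of x only for n in
   engel_indices x (elsewhere it is a junk value coming from 1 / 0 = 0). *)
definition engel_digit :: "nat \<Rightarrow> real \<Rightarrow> int" where
  "engel_digit n x = \<lceil>1 / (engel_map ^^ (n - 1)) x\<rceil>"

definition engel_indices :: "real \<Rightarrow> nat set" where
  "engel_indices x = {n. 1 \<le> n \<and> (engel_map ^^ (n - 1)) x \<noteq> 0}"

(* The infimum is taken in ennreal, so the infimum of the empty set is \<infinity>. The
   terms are positive, so unconditional summability over the index set is convergence of
   the series; it holds trivially when there are finitely many digits. *)
definition convergence_exponent :: "real \<Rightarrow> ennreal" where
  "convergence_exponent x =
     (INF s \<in> {s. 0 \<le> s \<and>
        (\<lambda>n. real_of_int (engel_digit n x) powr (- s)) summable_on engel_indices x}.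
        ennreal s)"

end

(* Upper bound. If the convergence exponent of x is at least \<alpha>, then d_n(x) \<le> n^c for infinitely
   many n, for any c > 1 / \<alpha>. A cylinder with digits d_1 \<le> ... \<le> d_n has diameter at most
   1 / (d_1 ... d_n), and the sum of the s-th powers of these over all strings with entries at most N
   is bounded by z^(-n) \<Prod>_{2 \<le> j \<le> N} 1 / (1 - z j^(-s)), that is, by z^(-n) exp(O(N^(1-s))).
   With N = n^c and z > 1 this is summable in n as soon as c (1 - s) < 1, so the limsup set is null in
   dimension s.

   Lower bound. For \<alpha> = 0 the upper bound makes the set of positive exponent Lebesgue null. For
   0 < \<alpha> < 1 let c = 1 / \<alpha> and let the n-th digit range over about n^(c-1) consecutive integers in
   [n^c, (n+1)^c). All such x have exponent \<alpha>, and reading the choices as a mixed radix expansion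
   maps them onto [0,1) by a map that is Hoelder of every order s < 1 - \<alpha>; hence their
   s-dimensional measure is positive. *)

theory Submission
  imports Defs "HOL-Real_Asymp.Real_Asymp"
begin

subsection \<open>Hausdorff measure and dimension\<close>

lemma diam_powr_empty [simp]: "diam_powr s {} = 0"
  by (simp add: diam_powr_def)

lemma diam_powr_nonempty: "s > 0 \<Longrightarrow> U \<noteq> {} \<Longrightarrow> diam_powr s U = ennreal (diameter U powr s)"
  by (simp add: diam_powr_def)

lemma diam_powr_antimono:
  assumes "0 \<le> s" "s \<le> t" "bounded U" "diameter U \<le> 1"
  shows "diam_powr t U \<le> diam_powr s U"
proof -
  have "0 \<le> diameter U"
    using assms(3) by (rule diameter_ge_0)
  then have "diameter U powr t \<le> diameter U powr s" and "diameter U powr t \<le> 1"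
    using assms powr_mono'[of s t "diameter U"] powr_le1[of t "diameter U"] by auto
  then show ?thesis
    using assms by (auto simp: diam_powr_def ennreal_le_1 intro: ennreal_leI)
qed

section \<open>Premeasures at a fixed scale: monotonicity, subadditivity, Lipschitz images\<close>

lemma hausdorff_premeasure_le:
  "U \<in> delta_covers \<delta> A \<Longrightarrow> hausdorff_premeasure s \<delta> A \<le> (\<Sum>i. diam_powr s (U i))"
  unfolding hausdorff_premeasure_def by (rule INF_lower)

lemma hausdorff_premeasure_lessE:
  assumes "hausdorff_premeasure s \<delta> A < x"
  obtains U where "U \<in> delta_covers \<delta> A" "(\<Sum>i. diam_powr s (U i)) < x"
  using assms unfolding hausdorff_premeasure_def INF_less_iff by blast

lemma hausdorff_premeasure_mono:
  "A \<subseteq> B \<Longrightarrow> hausdorff_premeasure s \<delta> A \<le> hausdorff_premeasure s \<delta> B"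
  unfolding hausdorff_premeasure_def
  by (rule INF_superset_mono) (auto simp: delta_covers_def)

lemma hausdorff_premeasure_antimono_delta:
  "\<delta> \<le> \<delta>' \<Longrightarrow> hausdorff_premeasure s \<delta>' A \<le> hausdorff_premeasure s \<delta> A"
  unfolding hausdorff_premeasure_def
  by (rule INF_superset_mono) (auto simp: delta_covers_def intro: order_trans)

lemma hausdorff_premeasure_antimono_exponent:
  assumes "0 \<le> s" "s \<le> t" "\<delta> \<le> 1"
  shows "hausdorff_premeasure t \<delta> A \<le> hausdorff_premeasure s \<delta> A"
  unfolding hausdorff_premeasure_def
  using assms
  by (intro INF_mono bexI suminf_le summableI)
    (auto simp: delta_covers_def intro!: diam_powr_antimono intro: order_trans)

lemma hausdorff_premeasure_empty [simp]: "0 \<le> \<delta> \<Longrightarrow> hausdorff_premeasure s \<delta> {} = 0"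
  using hausdorff_premeasure_le[of "\<lambda>_. {}" \<delta> "{}" s] by (simp add: delta_covers_def)

text \<open>Covers of the \<open>A i\<close> whose sums exceed the infimum by at most e / 2^(i+1)
  are enumerated through \<open>prod_decode\<close> as a single cover at the same scale.\<close>

lemma hausdorff_premeasure_UN_le:
  fixes A :: "nat \<Rightarrow> 'a::metric_space set"
  shows "hausdorff_premeasure s \<delta> (\<Union>i. A i) \<le> (\<Sum>i. hausdorff_premeasure s \<delta> (A i))"
proof (rule ennreal_le_epsilon)
  fix e :: real assume fin: "(\<Sum>i. hausdorff_premeasure s \<delta> (A i)) < top" and "e > 0"
  define \<epsilon> where "\<epsilon> i = ennreal (e * (1 / 2) ^ Suc i)" for i
  have lt: "hausdorff_premeasure s \<delta> (A i) < hausdorff_premeasure s \<delta> (A i) + \<epsilon> i" for i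
  proof -
    \<comment> \<open>Finiteness makes the addition of \<open>\<epsilon> i\<close> a strict
      increase, so that a cover with sum below the increased value exists.\<close>
    have "hausdorff_premeasure s \<delta> (A i) \<noteq> top"
      using fin ennreal_suminf_lessD by (metis less_irrefl)
    then show ?thesis
      using \<open>e > 0\<close> ennreal_add_left_cancel_less[of "hausdorff_premeasure s \<delta> (A i)" 0 "\<epsilon> i"]
      by (simp add: \<epsilon>_def)
  qed
  have "\<exists>U. U \<in> delta_covers \<delta> (A i) \<and>
      (\<Sum>j. diam_powr s (U j)) \<le> hausdorff_premeasure s \<delta> (A i) + \<epsilon> i" for i
    using hausdorff_premeasure_lessE[OF lt[of i]] less_imp_le by metis
  then obtain U where U: "\<And>i. U i \<in> delta_covers \<delta> (A i)"
      "\<And>i. (\<Sum>j. diam_powr s (U i j)) \<le> hausdorff_premeasure s \<delta> (A i) + \<epsilon> i"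
    by metis
  define V where "V k = case_prod U (prod_decode k)" for k
  have "V \<in> delta_covers \<delta> (\<Union>i. A i)"
  proof -
    have "x \<in> (\<Union>k. V k)" if x: "x \<in> A i" for x i
    proof -
      obtain j where "x \<in> U i j"
        using U(1)[of i] x unfolding delta_covers_def by blast
      then have "x \<in> V (prod_encode (i, j))" by (simp add: V_def)
      then show ?thesis by blast
    qed
    moreover have "bounded (V k) \<and> diameter (V k) \<le> \<delta>" for k
      using U(1)[of "fst (prod_decode k)"] by (simp add: delta_covers_def V_def split_beta)
    ultimately show ?thesis
      unfolding delta_covers_def by blast
  qed
  then have "hausdorff_premeasure s \<delta> (\<Union>i. A i) \<le> (\<Sum>k. diam_powr s (V k))"
    by (rule hausdorff_premeasure_le)
  also have "\<dots> = (\<Sum>k. (\<lambda>(i, j). diam_powr s (U i j)) (prod_decode k))"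
    by (simp add: V_def split_beta)
  also have "\<dots> = (\<Sum>i. \<Sum>j. diam_powr s (U i j))"
    by (rule suminf_ennreal_2dimen) simp
  also have "\<dots> \<le> (\<Sum>i. hausdorff_premeasure s \<delta> (A i) + \<epsilon> i)"
    using U(2) by (intro suminf_le summableI)
  also have "\<dots> = (\<Sum>i. hausdorff_premeasure s \<delta> (A i)) + (\<Sum>i. \<epsilon> i)"
    by (rule suminf_add [symmetric]) (rule summableI)+
  also have "(\<Sum>i. \<epsilon> i) = ennreal e"
    unfolding \<epsilon>_def using \<open>e > 0\<close> sums_mult[OF power_half_series, of e]
    by (intro suminf_ennreal_eq) auto
  finally show "hausdorff_premeasure s \<delta> (\<Union>i. A i)
      \<le> (\<Sum>i. hausdorff_premeasure s \<delta> (A i)) + ennreal e" .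
qed

lemma hausdorff_premeasure_Un_le:
  assumes "0 \<le> \<delta>"
  shows "hausdorff_premeasure s \<delta> (A \<union> B) \<le> hausdorff_premeasure s \<delta> A + hausdorff_premeasure s \<delta> B"
proof -
  \<comment> \<open>The pair is padded to a sequence; for 0 \<le> \<delta> the padding has
    premeasure zero.\<close>
  define C where "C i = (if i = 0 then A else if i = 1 then B else {})" for i :: nat
  have "A \<union> B = (\<Union>i. C i)"
    by (auto simp: C_def split: if_splits)
  then have "hausdorff_premeasure s \<delta> (A \<union> B) \<le> (\<Sum>i. hausdorff_premeasure s \<delta> (C i))"
    using hausdorff_premeasure_UN_le by metis
  also have "\<dots> = (\<Sum>i\<in>{0, 1}. hausdorff_premeasure s \<delta> (C i))"
    using assms by (intro suminf_finite) (auto simp: C_def)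
  finally show ?thesis
    by (simp add: C_def)
qed

text \<open>The images of \<open>A \<inter> U i\<close> have diameter at most c times that of
  \<open>U i\<close>; the intersection is taken because the Lipschitz bound holds only on
  \<open>A\<close>. The two scales are tracked explicitly since every Engel inverse branch has to
  halve the scale.\<close>

lemma hausdorff_premeasure_Lipschitz_image_le:
  fixes f :: "'a::metric_space \<Rightarrow> 'b::metric_space"
  assumes "s > 0" "c > 0" "c * \<delta> \<le> \<delta>'"
    and f: "\<And>x y. x \<in> A \<Longrightarrow> y \<in> A \<Longrightarrow> dist (f x) (f y) \<le> c * dist x y"
  shows "hausdorff_premeasure s \<delta>' (f ` A) \<le> ennreal (c powr s) * hausdorff_premeasure s \<delta> A"
proof -
  have "hausdorff_premeasure s \<delta>' (f ` A) \<le> ennreal (c powr s) * (\<Sum>i. diam_powr s (U i))"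
    if U: "U \<in> delta_covers \<delta> A" for U
  proof -
    define V where "V i = f ` (A \<inter> U i)" for i
    have bdd: "bounded (U i)" and diam: "diameter (U i) \<le> \<delta>" for i
      using U by (auto simp: delta_covers_def)
    have dist: "dist y y' \<le> c * diameter (U i)" if yy: "y \<in> V i" "y' \<in> V i" for i y y'
    proof -
      obtain x x' where "x \<in> A" "x' \<in> A" "x \<in> U i" "x' \<in> U i" "y = f x" "y' = f x'"
        using yy by (auto simp: V_def)
      then have "dist y y' \<le> c * dist x x'" using f by auto
      also have "\<dots> \<le> c * diameter (U i)"
        using diameter_bounded_bound[OF bdd] \<open>x \<in> U i\<close> \<open>x' \<in> U i\<close> \<open>c > 0\<close> by auto
      finally show ?thesis .
    qed
    have bddV: "bounded (V i)" for i
      unfolding bounded_two_points using dist by blast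
    have diamV: "diameter (V i) \<le> c * diameter (U i)" for i
    proof (cases "V i = {}")
      case True
      then show ?thesis using \<open>c > 0\<close> diameter_ge_0[OF bdd, of i] by simp
    next
      case False
      then have "(SUP (y, y')\<in>V i \<times> V i. dist y y') \<le> c * diameter (U i)"
        by (intro cSUP_least) (auto intro: dist)
      then show ?thesis using False by (simp add: diameter_def)
    qed
    have "diameter (V i) \<le> \<delta>'" for i
      using mult_left_mono[OF diam[of i], of c] diamV[of i] assms(2,3) by linarith
    moreover have "f ` A \<subseteq> (\<Union>i. V i)"
      using U unfolding delta_covers_def V_def by blast
    ultimately have "V \<in> delta_covers \<delta>' (f ` A)"
      using bddV by (simp add: delta_covers_def)
    then have "hausdorff_premeasure s \<delta>' (f ` A) \<le> (\<Sum>i. diam_powr s (V i))"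
      by (rule hausdorff_premeasure_le)
    also have "\<dots> \<le> (\<Sum>i. ennreal (c powr s) * diam_powr s (U i))"
    proof (intro suminf_le summableI)
      fix i
      have "diam_powr s (V i) \<le> ennreal ((c * diameter (U i)) powr s)"
        using assms(1) diamV[of i] diameter_ge_0[OF bddV, of i]
        by (auto simp: diam_powr_def intro!: ennreal_leI powr_mono2)
      moreover have "V i = {}" if "U i = {}"
        using that by (simp add: V_def)
      ultimately show "diam_powr s (V i) \<le> ennreal (c powr s) * diam_powr s (U i)"
        using assms(1,2) diameter_ge_0[OF bdd, of i]
        by (cases "U i = {}") (auto simp: diam_powr_nonempty powr_mult ennreal_mult)
    qed
    also have "\<dots> = ennreal (c powr s) * (\<Sum>i. diam_powr s (U i))"
      by (rule ennreal_suminf_cmult)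
    finally show ?thesis .
  qed
  note le = this
  \<comment> \<open>To pass to the infimum over all covers, the constant is first moved to the left
    by its inverse and multiplied back afterwards.\<close>
  let ?c = "ennreal (c powr s)" and ?c' = "ennreal (c powr (- s))"
  have cc': "?c' * ?c = 1" "?c * ?c' = 1"
    using assms(2) by (simp_all flip: ennreal_mult powr_add)
  have "?c' * hausdorff_premeasure s \<delta>' (f ` A) \<le> hausdorff_premeasure s \<delta> A"
    unfolding hausdorff_premeasure_def[of s \<delta> A]
  proof (rule INF_greatest)
    fix U assume "U \<in> delta_covers \<delta> A"
    from mult_left_mono[OF le[OF this], of ?c'] cc'(1)
    show "?c' * hausdorff_premeasure s \<delta>' (f ` A) \<le> (\<Sum>i. diam_powr s (U i))"
      by (simp flip: mult.assoc)
  qed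
  from mult_left_mono[OF this, of ?c] cc'(2) show ?thesis
    by (simp flip: mult.assoc)
qed

section \<open>From premeasures to measure and dimension\<close>

lemma hausdorff_premeasure_le_measure:
  "\<delta> > 0 \<Longrightarrow> hausdorff_premeasure s \<delta> A \<le> hausdorff_measure s A"
  unfolding hausdorff_measure_def by (rule SUP_upper) simp

lemma hausdorff_measure_zeroI:
  assumes "\<And>\<delta> e. 0 < \<delta> \<Longrightarrow> 0 < e \<Longrightarrow> hausdorff_premeasure s \<delta> A \<le> ennreal e"
  shows "hausdorff_measure s A = 0"
proof -
  have "hausdorff_premeasure s \<delta> A \<le> 0" if "0 < \<delta>" for \<delta>
    by (rule ennreal_le_epsilon) (use assms that in simp)
  then show ?thesis
    by (simp add: hausdorff_measure_def)
qed

lemma hausdorff_dim_mono: "A \<subseteq> B \<Longrightarrow> hausdorff_dim A \<le> hausdorff_dim B"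
proof -
  assume "A \<subseteq> B"
  then have "hausdorff_measure s A \<le> hausdorff_measure s B" for s
    unfolding hausdorff_measure_def by (intro SUP_mono' hausdorff_premeasure_mono)
  then show ?thesis
    unfolding hausdorff_dim_def
    by (intro INF_superset_mono) (auto, metis le_zero_eq)
qed

text \<open>Exponents just above \<open>a\<close> suffice for the infimum. The window of length
  \<open>e\<close> is there because the cylinder estimate covers only exponents below 1.\<close>

lemma hausdorff_dim_leI:
  assumes "0 \<le> a" and "\<And>s. a < s \<Longrightarrow> s < a + e \<Longrightarrow> hausdorff_measure s A = 0" and "e > 0"
  shows "hausdorff_dim A \<le> ennreal a"
proof (rule ennreal_le_epsilon)
  fix r :: real assume "r > 0"
  define s where "s = a + min r (e / 2)"
  have "hausdorff_measure s A = 0"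
    using \<open>r > 0\<close> \<open>e > 0\<close> by (intro assms(2)) (auto simp: s_def min_def)
  then have "hausdorff_dim A \<le> ennreal s"
    unfolding hausdorff_dim_def using assms \<open>r > 0\<close> by (intro INF_lower) (auto simp: s_def)
  also have "\<dots> \<le> ennreal a + ennreal r"
    using assms \<open>r > 0\<close> by (auto simp: s_def simp flip: ennreal_plus intro!: ennreal_leI)
  finally show "hausdorff_dim A \<le> ennreal a + ennreal r" .
qed

text \<open>A null exponent s < a would make every larger exponent null at scale 1. Testing scale 1
  alone is enough, since the measure dominates every premeasure.\<close>

lemma hausdorff_dim_geI:
  assumes "\<And>s. 0 < s \<Longrightarrow> s < a \<Longrightarrow> hausdorff_premeasure s 1 A \<noteq> 0"
  shows "ennreal a \<le> hausdorff_dim A"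
  unfolding hausdorff_dim_def
proof (rule INF_greatest, safe)
  fix s :: real assume s: "0 \<le> s" "hausdorff_measure s A = 0"
  show "ennreal a \<le> ennreal s"
  proof (rule ccontr)
    assume "\<not> ennreal a \<le> ennreal s"
    then have "s < a"
      using ennreal_leI by (meson not_le)
    \<comment> \<open>The midpoint is a positive exponent even when s = 0.\<close>
    define t where "t = (s + a) / 2"
    have "hausdorff_premeasure t 1 A \<le> hausdorff_premeasure s 1 A"
      using s \<open>s < a\<close> by (intro hausdorff_premeasure_antimono_exponent) (auto simp: t_def)
    also have "\<dots> \<le> 0"
      using hausdorff_premeasure_le_measure[of 1 s A] s by simp
    finally show False
      using assms[of t] s \<open>s < a\<close> by (simp add: t_def)
  qed
qed

text \<open>A cover of \<open>A\<close> with small s-sum pulls back to a cover of \<open>E\<close>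
  by intervals of radius K diam^s, of total length at most 2 K times that sum. With E = [0,1) this
  plays the part of the mass distribution principle.\<close>

lemma negligible_if_inverse_Hoelder:
  fixes E :: "real set" and g :: "real \<Rightarrow> 'a::metric_space"
  assumes "s > 0" "hausdorff_premeasure s 1 A = 0" "g ` E \<subseteq> A"
    and g: "\<And>u v. u \<in> E \<Longrightarrow> v \<in> E \<Longrightarrow> \<bar>u - v\<bar> \<le> C * dist (g u) (g v) powr s"
  shows "negligible E"
proof -
  \<comment> \<open>\<open>C\<close> may be nonpositive, whereas the radii and quotients below call
    for a positive constant.\<close>
  define K where "K = max C 1"
  have "K > 0" by (simp add: K_def)
  have g: "\<bar>u - v\<bar> \<le> K * dist (g u) (g v) powr s" if "u \<in> E" "v \<in> E" for u v
    using g[OF that] mult_right_mono[of C K "dist (g u) (g v) powr s"] by (auto simp: K_def)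
  show ?thesis
    unfolding negligible_outer_le
  proof safe
    fix e :: real assume "e > 0"
    have "hausdorff_premeasure s 1 A < ennreal (e / (2 * K))"
      using assms \<open>e > 0\<close> \<open>K > 0\<close> by simp
    then obtain U where U: "U \<in> delta_covers 1 A" and small: "(\<Sum>i. diam_powr s (U i)) < ennreal (e / (2 * K))"
      by (rule hausdorff_premeasure_lessE)
    \<comment> \<open>Some point of \<open>E\<close> mapped into \<open>U i\<close> serves as
      centre. Where there is none the centre is arbitrary; the covering argument concerns only
      indices with \<open>g v \<in> U i\<close> for some v in \<open>E\<close>.\<close>
    define u where "u i = (SOME u. u \<in> E \<and> g u \<in> U i)" for i
    define r where "r i = (if U i = {} then 0 else K * diameter (U i) powr s)" for i
    have bdd: "bounded (U i)" for i using U by (auto simp: delta_covers_def)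
    have r: "r i \<ge> 0" for i using \<open>K > 0\<close> by (auto simp: r_def)
    have sub: "E \<subseteq> (\<Union>i. cball (u i) (r i))"
    proof
      fix v assume v: "v \<in> E"
      then have "g v \<in> A" using assms(3) by blast
      then obtain i where i: "g v \<in> U i" using U by (auto simp: delta_covers_def)
      then have u: "u i \<in> E" "g (u i) \<in> U i"
        using v someI[of "\<lambda>u. u \<in> E \<and> g u \<in> U i" v] by (auto simp: u_def)
      have "\<bar>u i - v\<bar> \<le> K * dist (g (u i)) (g v) powr s" using g u v by blast
      also have "\<dots> \<le> K * diameter (U i) powr s"
        using diameter_bounded_bound[OF bdd u(2) i] \<open>s > 0\<close> \<open>K > 0\<close>
        by (intro mult_left_mono powr_mono2) auto
      also have "\<dots> = r i" using i by (auto simp: r_def)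
      finally show "v \<in> (\<Union>i. cball (u i) (r i))" by (auto simp: dist_real_def)
    qed
    have rd: "ennreal (r i) = ennreal K * diam_powr s (U i)" for i
      using \<open>K > 0\<close> \<open>s > 0\<close> by (auto simp: r_def diam_powr_def ennreal_mult)
    have "emeasure lebesgue (\<Union>i. cball (u i) (r i)) \<le> (\<Sum>i. emeasure lebesgue (cball (u i) (r i)))"
      by (rule emeasure_subadditive_countably) auto
    also have "\<dots> = (\<Sum>i. ennreal (2 * K) * diam_powr s (U i))"
    proof (rule suminf_cong)
      fix i
      have "emeasure lebesgue (cball (u i) (r i)) = ennreal (2 * r i)"
        using r[of i] by (simp add: cball_eq_atLeastAtMost)
      also have "\<dots> = ennreal 2 * (ennreal K * diam_powr s (U i))"
        using r[of i] rd[of i] by (simp add: ennreal_mult)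
      finally show "emeasure lebesgue (cball (u i) (r i)) = ennreal (2 * K) * diam_powr s (U i)"
        using \<open>K > 0\<close> by (simp add: ennreal_mult mult.assoc)
    qed
    also have "\<dots> = ennreal (2 * K) * (\<Sum>i. diam_powr s (U i))"
      by (rule ennreal_suminf_cmult)
    also have "\<dots> \<le> ennreal (2 * K) * ennreal (e / (2 * K))"
      using small by (intro mult_left_mono) auto
    also have "\<dots> = ennreal e"
      using \<open>K > 0\<close> \<open>e > 0\<close> by (subst ennreal_mult [symmetric]) auto
    finally have le: "emeasure lebesgue (\<Union>i. cball (u i) (r i)) \<le> ennreal e" .
    then have "(\<Union>i. cball (u i) (r i)) \<in> lmeasurable"
      by (intro fmeasurableI) (auto intro: le_less_trans)
    moreover have "measure lebesgue (\<Union>i. cball (u i) (r i)) \<le> e"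
      using le \<open>e > 0\<close> by (simp add: measure_def enn2real_leI)
    ultimately show "\<exists>T. E \<subseteq> T \<and> T \<in> lmeasurable \<and> measure lebesgue T \<le> e"
      using sub by blast
  qed
qed

subsection \<open>Upper bound\<close>

lemma engel_map_props:
  assumes "0 \<le> x" "x < 1"
  shows "0 \<le> engel_map x" "engel_map x \<le> x"
proof -
  have "0 \<le> engel_map x \<and> engel_map x \<le> x" if "x > 0"
  proof -
    have "1 / x \<le> of_int \<lceil>1 / x\<rceil>" "of_int \<lceil>1 / x\<rceil> < 1 / x + 1"
      by linarith+
    then have "x * (1 / x) \<le> x * of_int \<lceil>1 / x\<rceil>" "x * of_int \<lceil>1 / x\<rceil> \<le> x * (1 / x + 1)"
      using that by (intro mult_left_mono; simp)+
    then show ?thesis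
      using that by (simp add: engel_map_def distrib_left)
  qed
  then show "0 \<le> engel_map x" "engel_map x \<le> x"
    using assms by (cases "x = 0"; force simp: engel_map_def)+
qed

lemma engel_iterate_bounds:
  assumes "0 \<le> x" "x < 1"
  shows "0 \<le> (engel_map ^^ n) x" "(engel_map ^^ n) x < 1"
proof (induction n)
  case (Suc n)
  {
    case 1
    show ?case using engel_map_props[of "(engel_map ^^ n) x"] Suc by simp
  next
    case 2
    show ?case using engel_map_props[of "(engel_map ^^ n) x"] Suc by simp
  }
qed (use assms in simp_all)

text \<open>Iterates \<open>engel_map x \<le> x\<close>. After taking reciprocals this says that the
  digits are nondecreasing.\<close>

lemma engel_iterate_antimono:
  assumes "0 \<le> x" "x < 1" "i \<le> j"
  shows "(engel_map ^^ j) x \<le> (engel_map ^^ i) x"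
  using \<open>i \<le> j\<close>
proof (induction rule: dec_induct)
  case (step n)
  then show ?case
    using engel_map_props(2)[OF engel_iterate_bounds[OF assms(1,2)], of n] by simp
qed simp

lemma engel_digit_ge_2:
  assumes "0 < x" "x < 1"
  shows "2 \<le> \<lceil>1 / x\<rceil>"
proof -
  have "1 < 1 / x" using assms by simp
  then show ?thesis
    using less_ceiling_iff[of 1 "1 / x"] by simp
qed

text \<open>Obtained by solving \<open>engel_map x\<close> = x d - 1 for x. The inverse branches y
  -> (1 + y) / d are the contractions from which the covers are built.\<close>

lemma engel_map_inverse:
  assumes "0 < x" "x < 1"
  shows "x = (1 + engel_map x) / real (nat \<lceil>1 / x\<rceil>)"
proof -
  have "real (nat \<lceil>1 / x\<rceil>) = of_int \<lceil>1 / x\<rceil>" "of_int \<lceil>1 / x\<rceil> \<noteq> (0 :: real)"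
    using engel_digit_ge_2[OF assms] by linarith+
  then show ?thesis
    using assms by (simp add: engel_map_def)
qed

section \<open>Covers by images of the inverse branches\<close>

lemma hausdorff_premeasure_unit_interval_le:
  assumes "0 < s"
  shows "hausdorff_premeasure s 1 {0..1::real} \<le> 1"
proof -
  define U :: "nat \<Rightarrow> real set" where "U i = (if i = 0 then {0..1} else {})" for i
  have "hausdorff_premeasure s 1 {0..1::real} \<le> (\<Sum>i. diam_powr s (U i))"
    by (rule hausdorff_premeasure_le) (auto simp: delta_covers_def U_def)
  also have "\<dots> = (\<Sum>i\<in>{0}. diam_powr s (U i))"
    by (rule suminf_finite) (auto simp: U_def)
  also have "\<dots> = 1"
    using assms by (simp add: U_def diam_powr_nonempty)
  finally show ?thesis by simp
qed

text \<open>Each nondecreasing string of n digits in {m..N} contributes the image of {0..1} under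
  its inverse branches, an interval of length 1 / (d_1 ... d_n) containing the cylinder. The last
  argument is the lower bound for the next digit.\<close>

fun engel_cover :: "nat \<Rightarrow> nat \<Rightarrow> nat \<Rightarrow> real set" where
  "engel_cover N 0 m = {0..1}"
| "engel_cover N (Suc n) m = (\<Union>d\<in>{m..N}. (\<lambda>y. (1 + y) / real d) ` engel_cover N n d)"

lemma in_engel_cover:
  assumes "0 \<le> x" "x < 1"
    and "\<And>i. i < n \<Longrightarrow> (engel_map ^^ i) x \<noteq> 0"
    and "\<And>i. i < n \<Longrightarrow> int m \<le> \<lceil>1 / (engel_map ^^ i) x\<rceil>"
    and "\<And>i. i < n \<Longrightarrow> \<lceil>1 / (engel_map ^^ i) x\<rceil> \<le> int N"
  shows "x \<in> engel_cover N n m"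
  using assms
proof (induction n arbitrary: x m)
  case (Suc n)
  define d where "d = nat \<lceil>1 / x\<rceil>"
  have x: "0 < x" "x < 1"
    using Suc.prems(1,2) Suc.prems(3)[of 0] by auto
  have dx: "int d = \<lceil>1 / x\<rceil>"
    using engel_digit_ge_2[OF x] by (simp add: d_def)
  have it: "(engel_map ^^ i) (engel_map x) = (engel_map ^^ Suc i) x" for i
    by (simp only: funpow_Suc_right o_apply)
  have "engel_map x \<in> engel_cover N n d"
  proof (rule Suc.IH)
    show "0 \<le> engel_map x" "engel_map x < 1"
      using engel_map_props[of x] x by auto
    fix i assume i: "i < n"
    show nz: "(engel_map ^^ i) (engel_map x) \<noteq> 0"
      using Suc.prems(3)[of "Suc i"] i unfolding it by simp
    show "\<lceil>1 / (engel_map ^^ i) (engel_map x)\<rceil> \<le> int N"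
      using Suc.prems(5)[of "Suc i"] i unfolding it by simp
    have "0 < (engel_map ^^ Suc i) x" "(engel_map ^^ Suc i) x \<le> x"
      using nz engel_iterate_bounds[of x "Suc i"] engel_iterate_antimono[of x 0 "Suc i"] x
      unfolding it by auto
    \<comment> \<open>As the digits are nondecreasing, \<open>d\<close> bounds all later ones from
      below.\<close>
    then show "int d \<le> \<lceil>1 / (engel_map ^^ i) (engel_map x)\<rceil>"
      unfolding it dx using x by (intro ceiling_mono) (simp add: frac_le)
  qed
  moreover have "d \<in> {m..N}"
    using Suc.prems(4)[of 0] Suc.prems(5)[of 0] dx by simp
  moreover have "x = (1 + engel_map x) / real d"
    using engel_map_inverse[OF x] by (simp add: d_def)
  ultimately show ?case by auto
qed simp

text \<open>The product is the generating function, in \<open>z\<close>, of the sums of \<open>(d\<^sub>1 \<cdots> d\<^sub>n) powr - s\<close>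
  over nondecreasing digit strings with entries in \<open>{m..N}\<close>.\<close>

lemma hausdorff_premeasure_engel_cover_le:
  assumes "0 < s" "0 < z" "z * 2 powr - s < 1" "2 \<le> m"
  shows "hausdorff_premeasure s ((1/2) ^ n) (engel_cover N n m)
    \<le> ennreal ((1 / z) ^ n * (\<Prod>j=m..N. 1 / (1 - z * real j powr - s)))"
proof -
  define P where "P m = (\<Prod>j=m..N. 1 / (1 - z * real j powr - s))" for m
  have q: "z * real j powr - s < 1" if "2 \<le> j" for j
  proof -
    have "real j powr - s \<le> 2 powr - s"
      using that assms by (intro powr_mono2') auto
    then show ?thesis
      using assms mult_left_mono[of "real j powr - s" "2 powr - s" z] by linarith
  qed
  have P1: "1 \<le> P m" if "2 \<le> m" for m
    unfolding P_def
  proof (rule prod_ge_1)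
    fix j assume "j \<in> {m..N}"
    then show "1 \<le> 1 / (1 - z * real j powr - s)"
      using q[of j] that assms by (simp add: le_divide_eq)
  qed
  have "hausdorff_premeasure s ((1/2) ^ n) (engel_cover N n m) \<le> ennreal ((1 / z) ^ n * P m)"
    using \<open>2 \<le> m\<close>
  proof (induction n arbitrary: m)
    case 0
    have "hausdorff_premeasure s 1 {0..1::real} \<le> 1"
      using assms by (intro hausdorff_premeasure_unit_interval_le)
    also have "\<dots> \<le> ennreal (P m)"
      using P1[OF 0] by simp
    finally show ?case by simp
  next
    case (Suc n)
    show ?case
      using Suc.prems
    \<comment> \<open>Inner induction downwards on m, starting at m > N, where no first digit is
      admissible and the cover is empty.\<close>
    proof (induction "Suc N - m" arbitrary: m)
      case 0
      then show ?case by simp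
    next
      case (Suc k)
      then have "m \<le> N" and IH: "hausdorff_premeasure s ((1/2) ^ Suc n) (engel_cover N (Suc n) (Suc m))
          \<le> ennreal ((1 / z) ^ Suc n * P (Suc m))"
        using Suc.hyps(1)[of "Suc m"] by auto
      let ?\<phi> = "\<lambda>y. (1 + y) / real m"
      have "{m..N} = insert m {Suc m..N}"
        using \<open>m \<le> N\<close> by auto
      \<comment> \<open>The first digit is either m, leaving n digits that are at least m, or it is
        at least m + 1.\<close>
      then have split: "engel_cover N (Suc n) m = ?\<phi> ` engel_cover N n m \<union> engel_cover N (Suc n) (Suc m)"
        by simp
      have "hausdorff_premeasure s ((1/2) ^ Suc n) (?\<phi> ` engel_cover N n m)
          \<le> ennreal ((1 / real m) powr s) * hausdorff_premeasure s ((1/2) ^ n) (engel_cover N n m)"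
      proof (rule hausdorff_premeasure_Lipschitz_image_le)
        show "1 / real m * (1/2) ^ n \<le> (1/2) ^ Suc n"
          using \<open>2 \<le> m\<close> by (auto intro!: mult_right_mono simp: field_simps)
        show "dist (?\<phi> x) (?\<phi> y) \<le> 1 / real m * dist x y" for x y
          by (simp add: dist_real_def flip: diff_divide_distrib)
      qed (use assms \<open>2 \<le> m\<close> in auto)
      also have "\<dots> \<le> ennreal ((1 / real m) powr s) * ennreal ((1 / z) ^ n * P m)"
        using Suc.prems \<open>\<And>m. 2 \<le> m \<Longrightarrow> hausdorff_premeasure s ((1/2) ^ n) (engel_cover N n m) \<le> ennreal ((1 / z) ^ n * P m)\<close>
        by (intro mult_left_mono) auto
      also have "\<dots> = ennreal (real m powr - s * ((1 / z) ^ n * P m))"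
        using \<open>2 \<le> m\<close> P1[of m] assms
        by (subst ennreal_mult [symmetric]) (auto simp: powr_divide powr_minus_divide)
      finally have "hausdorff_premeasure s ((1/2) ^ Suc n) (engel_cover N (Suc n) m)
          \<le> ennreal (real m powr - s * ((1 / z) ^ n * P m)) + ennreal ((1 / z) ^ Suc n * P (Suc m))"
        unfolding split using IH
        by (intro order_trans[OF hausdorff_premeasure_Un_le] add_mono) auto
      also have "\<dots> = ennreal (real m powr - s * ((1 / z) ^ n * P m) + (1 / z) ^ Suc n * P (Suc m))"
        using \<open>2 \<le> m\<close> P1[of m] P1[of "Suc m"] assms by (intro ennreal_plus [symmetric]) auto
      \<comment> \<open>The factor at j = m merges the two contributions exactly: m^(-s) z^(-n) +
        z^(-n-1) (1 - z m^(-s)) = z^(-n-1).\<close>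
      also have "P m = 1 / (1 - z * real m powr - s) * P (Suc m)"
        using \<open>m \<le> N\<close> by (simp add: P_def prod.atLeast_Suc_atMost)
      then have "P (Suc m) = (1 - z * real m powr - s) * P m"
        using q[OF \<open>2 \<le> m\<close>] by simp
      then have "real m powr - s * ((1 / z) ^ n * P m) + (1 / z) ^ Suc n * P (Suc m) = (1 / z) ^ Suc n * P m"
        using assms by (simp add: field_simps)
      finally show ?case .
    qed
  qed
  then show ?thesis by (simp add: P_def)
qed

text \<open>A discrete form of comparison with the integral: by Bernoulli's inequality for the
  exponent 1 - s, the increment of x^(1-s) from N to N + 1 is at least (1 - s) (N + 1)^(-s).\<close>

lemma sum_powr_minus_le:
  assumes "0 < s" "s < 1"
  shows "(\<Sum>j=1..N. real j powr - s) \<le> real N powr (1 - s) / (1 - s)"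
proof (induction N)
  case (Suc N)
  let ?a = "1 - s" and ?M = "real (Suc N)"
  have "real N powr ?a \<le> ?M powr ?a - ?a * ?M powr - s"
  proof (cases "N = 0")
    case False
    \<comment> \<open>Convexity of exp between 0 and ln (1 + y), with weight 1 - s.\<close>
    have conc: "(1 + y) powr ?a \<le> 1 + ?a * y" if "-1 < y" for y :: real
    proof -
      have "(1 + y) powr ?a = exp (?a * ln (1 + y))" using that by (simp add: powr_def)
      also have "\<dots> \<le> ?a * exp (ln (1 + y)) + (1 - ?a) * exp 0"
        using convex_onD[OF exp_convex, of ?a 0 "ln (1 + y)"] assms by simp
      finally show ?thesis using that by (simp add: algebra_simps)
    qed
    have "?M * (1 + - 1 / ?M) = real N"
      unfolding distrib_left by simp
    then have "real N powr ?a = (?M * (1 + - 1 / ?M)) powr ?a"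
      by (rule arg_cong[OF sym])
    also have "\<dots> = ?M powr ?a * (1 + - 1 / ?M) powr ?a"
      using False by (subst powr_mult) (auto simp: field_simps)
    also have "\<dots> \<le> ?M powr ?a * (1 + ?a * (- 1 / ?M))"
      using False by (intro mult_left_mono conc) (auto simp: field_simps)
    also have "?M powr ?a = ?M * ?M powr - s"
      by (simp add: powr_diff powr_minus_divide)
    then have "?M powr ?a * (1 + ?a * (- 1 / ?M)) = ?M powr ?a - ?a * ?M powr - s"
      by (simp add: field_simps)
    finally show ?thesis .
  qed (use assms in simp)
  with Suc show ?case
    using assms by (simp add: field_simps)
qed simp

text \<open>Each factor is 1 / (1 - w) = 1 + w / (1 - w) \<le> exp (w / (1 - q)), where q = z 2^(-s)
  is the largest value of w = z j^(-s). The exponents then add up to a sum of powers j^(-s).\<close>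

lemma engel_prod_le:
  assumes "0 < s" "s < 1" "0 < z" "z * 2 powr - s < 1"
  defines "K \<equiv> z / (1 - z * 2 powr - s) / (1 - s)"
  shows "(\<Prod>j=2..N. 1 / (1 - z * real j powr - s)) \<le> exp (K * real N powr (1 - s))"
proof -
  define q where "q = z * 2 powr - s"
  define L where "L = z / (1 - q)"
  have L: "L > 0" "q < 1" using assms by (auto simp: L_def q_def)
  have "(\<Prod>j=2..N. 1 / (1 - z * real j powr - s)) \<le> (\<Prod>j=2..N. exp (L * real j powr - s))"
  proof (rule prod_mono)
    fix j assume j: "j \<in> {2..N}"
    let ?w = "z * real j powr - s"
    have "real j powr - s \<le> 2 powr - s"
      using j assms by (intro powr_mono2') auto
    then have w: "0 \<le> ?w" "?w \<le> q"
      using assms by (auto simp: q_def)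
    have "1 / (1 - ?w) = 1 + ?w / (1 - ?w)"
      using w L by (simp add: field_simps)
    also have "\<dots> \<le> 1 + ?w / (1 - q)"
      using w L by (intro add_left_mono frac_le) auto
    also have "\<dots> \<le> exp (?w / (1 - q))"
      by (rule exp_ge_add_one_self)
    finally show "0 \<le> 1 / (1 - ?w) \<and> 1 / (1 - ?w) \<le> exp (L * real j powr - s)"
      using w L by (simp add: L_def)
  qed
  also have "\<dots> = exp (L * (\<Sum>j=2..N. real j powr - s))"
    by (simp add: exp_sum sum_distrib_left)
  also have "\<dots> \<le> exp (L * (\<Sum>j=1..N. real j powr - s))"
    using L by (auto intro!: mult_left_mono sum_mono2)
  also have "\<dots> \<le> exp (L * (real N powr (1 - s) / (1 - s)))"
    using L(1) sum_powr_minus_le[OF assms(1,2), of N] by (intro exp_le_cancel_iff[THEN iffD2] mult_left_mono) auto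
  finally show ?thesis by (simp add: K_def L_def q_def)
qed

text \<open>With l = ln z / 2 one has z^(-n) = exp (- 2 l n), and K n^\<beta> \<le> l n eventually
  because \<beta> < 1. Half of the geometric decay survives.\<close>

lemma summable_exp_powr_geometric:
  fixes K \<beta> z :: real
  assumes "0 \<le> K" "\<beta> < 1" "1 < z"
  shows "summable (\<lambda>n. (1 / z) ^ n * exp (K * real n powr \<beta>))"
proof -
  define l where "l = ln z / 2"
  have "l > 0" using assms by (simp add: l_def)
  have "((\<lambda>n. real n powr (\<beta> - 1)) \<longlongrightarrow> 0) sequentially"
    using assms by (intro tendsto_neg_powr filterlim_real_sequentially) auto
  then have "((\<lambda>n. K * real n powr (\<beta> - 1)) \<longlongrightarrow> K * 0) sequentially"
    by (intro tendsto_intros)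
  then have "eventually (\<lambda>n. K * real n powr (\<beta> - 1) < l) sequentially"
    using \<open>l > 0\<close> by (auto dest: order_tendstoD(2))
  then have "eventually (\<lambda>n. norm ((1 / z) ^ n * exp (K * real n powr \<beta>)) \<le> exp (- l) ^ n) sequentially"
    using eventually_gt_at_top[of 0]
  proof eventually_elim
    case (elim n)
    have "real n powr \<beta> = real n powr (\<beta> - 1) * real n"
      using elim(2) by (simp add: powr_diff)
    then have "K * real n powr \<beta> \<le> l * real n"
      using elim mult_right_mono[of "K * real n powr (\<beta> - 1)" l "real n"] by (simp add: mult.assoc)
    then have "exp (K * real n powr \<beta>) \<le> exp (l * real n)" by simp
    moreover have "(1 / z) ^ n = exp (- 2 * l) ^ n"
      using assms by (simp add: l_def exp_minus inverse_eq_divide)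
    ultimately have "(1 / z) ^ n * exp (K * real n powr \<beta>) \<le> exp (- 2 * l) ^ n * exp (l * real n)"
      by (simp add: mult_left_mono)
    also have "\<dots> = exp (- l) ^ n"
      by (simp add: algebra_simps flip: exp_of_nat_mult exp_add)
    finally show ?case using assms by simp
  qed
  then show ?thesis
    using \<open>l > 0\<close> by (intro summable_comparison_test_ev[OF _ summable_geometric]) auto
qed

text \<open>If all digits from some index on exceeded n^(1/t), then for t < t' < \<alpha> the sum of
  d_n^(-t') would be dominated by the convergent sum of n^(-t'/t), so the exponent would be at most
  t'.\<close>

lemma small_engel_digits:
  assumes "0 < x" "x < 1" "convergence_exponent x \<ge> ennreal \<alpha>" "0 < t" "t < \<alpha>"
  shows "\<exists>n\<ge>k. (engel_map ^^ n) x \<noteq> 0 \<and> real_of_int \<lceil>1 / (engel_map ^^ n) x\<rceil> \<le> real (Suc n) powr (1 / t)"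
proof (rule ccontr)
  assume *: "\<not> ?thesis"
  define t' where "t' = (t + \<alpha>) / 2"
  have t': "t < t'" "t' < \<alpha>" using assms by (auto simp: t'_def)
  let ?f = "\<lambda>n. real_of_int (engel_digit n x) powr (- t')"
  have "summable (\<lambda>n. real n powr (- (t' / t)))"
    using assms t' by (subst summable_real_powr_iff) auto
  then have "(\<lambda>n. real n powr (- (t' / t))) summable_on UNIV"
    by (subst summable_on_UNIV_nonneg_real_iff) auto
  then have g: "(\<lambda>n. real n powr (- (t' / t))) summable_on (engel_indices x - {..k})"
    by (rule summable_on_subset_banach) auto
  have "?f summable_on (engel_indices x - {..k})"
  proof (rule summable_on_comparison_test[OF g])
    fix n assume n: "n \<in> engel_indices x - {..k}"
    \<comment> \<open>Digit number n belongs to the iterate n - 1, which is where the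
      \<open>Suc n\<close> of the statement comes from.\<close>
    then have "n - 1 \<ge> k" "(engel_map ^^ (n - 1)) x \<noteq> 0" "Suc (n - 1) = n"
      by (auto simp: engel_indices_def)
    then have "real n powr (1 / t) < real_of_int (engel_digit n x)"
      using * by (fastforce simp: engel_digit_def not_le)
    then have "?f n \<le> (real n powr (1 / t)) powr (- t')"
      using assms t' n by (intro powr_mono2') (auto simp: engel_indices_def)
    then show "?f n \<le> real n powr (- (t' / t))"
      by (simp add: powr_powr)
  qed auto
  moreover have "?f summable_on (engel_indices x \<inter> {..k})"
    by (rule summable_on_finite) auto
  ultimately have "?f summable_on ((engel_indices x - {..k}) \<union> (engel_indices x \<inter> {..k}))"
    by (rule summable_on_Un_disjoint) auto
  moreover have "(engel_indices x - {..k}) \<union> (engel_indices x \<inter> {..k}) = engel_indices x"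
    by auto
  ultimately have "convergence_exponent x \<le> ennreal t'"
    unfolding convergence_exponent_def using assms t' by (intro INF_lower) auto
  with assms(3) have "ennreal \<alpha> \<le> ennreal t'" by (rule order_trans)
  then show False using assms t' by (simp add: ennreal_le_iff)
qed

text \<open>A Borel-Cantelli argument: every point of the set lies in infinitely many
  \<open>C n\<close>, and the premeasures of the \<open>C n\<close> are summable.\<close>

lemma hausdorff_measure_convergence_exponent_ge:
  assumes "\<alpha> \<le> 1" "1 - \<alpha> < s" "s < 1"
  shows "hausdorff_measure s {x \<in> {0<..<1}. convergence_exponent x \<ge> ennreal \<alpha>} = 0"
proof -
  let ?E = "{x \<in> {0<..<1}. convergence_exponent x \<ge> ennreal \<alpha>}"
  have "0 < s" using assms by simp
  \<comment> \<open>The condition t < \<alpha> yields infinitely many digits at most n^(1/t), and t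
    > 1 - s makes the exponent \<open>\<beta>\<close> below smaller than 1.\<close>
  define t where "t = ((1 - s) + \<alpha>) / 2"
  have t: "1 - s < t" "t < \<alpha>" "0 < t" using assms by (auto simp: t_def)
  \<comment> \<open>A value strictly between 1 and 2^s: above 1 for geometric decay, below 2^s for a
    finite generating function.\<close>
  define z :: real where "z = 2 powr (s / 2)"
  have z: "1 < z" "z * 2 powr - s < 1"
    using \<open>0 < s\<close> by (auto simp: z_def gr_one_powr powr_less_one simp flip: powr_add)
  define K where "K = z / (1 - z * 2 powr - s) / (1 - s)"
  have "0 \<le> K" using z assms by (simp add: K_def)
  define \<beta> where "\<beta> = 1 / t * (1 - s)"
  have "\<beta> < 1" using t assms by (simp add: \<beta>_def)
  define N where "N n = nat \<lfloor>real n powr (1 / t)\<rfloor>" for n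
  define C where "C n = engel_cover (N n) n 2" for n
  define a where "a n = (1 / z) ^ n * exp (K * real n powr \<beta>)" for n
  have a: "summable a" "\<And>n. a n \<ge> 0"
    unfolding a_def using \<open>0 \<le> K\<close> \<open>\<beta> < 1\<close> z by (auto intro: summable_exp_powr_geometric)
  have C: "hausdorff_premeasure s ((1/2) ^ n) (C n) \<le> ennreal (a n)" for n
  proof -
    have "real (N n) \<le> real n powr (1 / t)" by (simp add: N_def)
    then have "real (N n) powr (1 - s) \<le> (real n powr (1 / t)) powr (1 - s)"
      using assms by (intro powr_mono2) auto
    also have "\<dots> = real n powr \<beta>" by (simp add: powr_powr \<beta>_def)
    finally have "exp (K * real (N n) powr (1 - s)) \<le> exp (K * real n powr \<beta>)"
      using \<open>0 \<le> K\<close> by (auto intro: mult_left_mono)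
    moreover have "(\<Prod>j=2..N n. 1 / (1 - z * real j powr - s)) \<le> exp (K * real (N n) powr (1 - s))"
      unfolding K_def using \<open>0 < s\<close> assms z by (intro engel_prod_le) auto
    ultimately have "(\<Prod>j=2..N n. 1 / (1 - z * real j powr - s)) \<le> exp (K * real n powr \<beta>)"
      by (rule order_trans [rotated])
    then have "(1 / z) ^ n * (\<Prod>j=2..N n. 1 / (1 - z * real j powr - s)) \<le> a n"
      using z unfolding a_def by (intro mult_left_mono) auto
    then show ?thesis
      using hausdorff_premeasure_engel_cover_le[of s z 2 n "N n"] \<open>0 < s\<close> z
      by (auto simp: C_def intro: order_trans ennreal_leI)
  qed
  have sub: "?E \<subseteq> (\<Union>n. C (n + k))" for k
  proof
    fix x assume "x \<in> ?E"
    then have x: "0 < x" "x < 1" "convergence_exponent x \<ge> ennreal \<alpha>" by auto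
    obtain n where n: "n \<ge> k" "(engel_map ^^ n) x \<noteq> 0"
        "real_of_int \<lceil>1 / (engel_map ^^ n) x\<rceil> \<le> real (Suc n) powr (1 / t)"
      using small_engel_digits[OF x t(3,2)] by blast
    have pos: "0 < (engel_map ^^ i) x" "(engel_map ^^ n) x \<le> (engel_map ^^ i) x" if "i < Suc n" for i
      using engel_iterate_antimono[of x i n] engel_iterate_bounds[of x n] n x that by auto
    have "x \<in> engel_cover (N (Suc n)) (Suc n) 2"
    proof (rule in_engel_cover)
      fix i assume i: "i < Suc n"
      show "(engel_map ^^ i) x \<noteq> 0" using pos[OF i] by simp
      show "int 2 \<le> \<lceil>1 / (engel_map ^^ i) x\<rceil>"
        using engel_digit_ge_2[of "(engel_map ^^ i) x"] pos[OF i] engel_iterate_bounds[of x i] x by auto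
      \<comment> \<open>By monotonicity a single small digit bounds all the digits before
        it.\<close>
      have "\<lceil>1 / (engel_map ^^ i) x\<rceil> \<le> \<lceil>1 / (engel_map ^^ n) x\<rceil>"
        using pos[OF i] pos[of n] by (intro ceiling_mono) (simp add: frac_le)
      also have "\<dots> \<le> int (N (Suc n))"
        using n(3) unfolding N_def by linarith
      finally show "\<lceil>1 / (engel_map ^^ i) x\<rceil> \<le> int (N (Suc n))" .
    qed (use x in auto)
    then have "x \<in> C ((Suc n - k) + k)" using n by (simp add: C_def)
    then show "x \<in> (\<Union>n. C (n + k))" by blast
  qed
  have "hausdorff_premeasure s \<delta> ?E \<le> ennreal e" if "\<delta> > 0" "e > 0" for \<delta> e
  proof -
    \<comment> \<open>Beyond \<open>k0\<close> the covers are finer than \<delta>; beyond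
      \<open>k1\<close> the tail of the sum is below e.\<close>
    obtain k0 where k0: "(1/2) ^ k0 < \<delta>"
      using real_arch_pow_inv[of \<delta> "1/2"] \<open>\<delta> > 0\<close> by auto
    obtain k1 where k1: "\<And>n. n \<ge> k1 \<Longrightarrow> norm (\<Sum>i. a (i + n)) < e"
      using suminf_exist_split[OF \<open>e > 0\<close> a(1)] by blast
    define k where "k = max k0 k1"
    have "hausdorff_premeasure s \<delta> ?E \<le> hausdorff_premeasure s \<delta> (\<Union>n. C (n + k))"
      by (rule hausdorff_premeasure_mono[OF sub])
    also have "\<dots> \<le> (\<Sum>n. hausdorff_premeasure s \<delta> (C (n + k)))"
      by (rule hausdorff_premeasure_UN_le)
    also have "\<dots> \<le> (\<Sum>n. ennreal (a (n + k)))"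
    proof (intro suminf_le summableI)
      fix n
      have "(1/2) ^ (n + k) \<le> (1/2 :: real) ^ k0"
        by (rule power_decreasing) (auto simp: k_def)
      then have "(1/2) ^ (n + k) \<le> \<delta>"
        using k0 by linarith
      then show "hausdorff_premeasure s \<delta> (C (n + k)) \<le> ennreal (a (n + k))"
        by (rule order_trans[OF hausdorff_premeasure_antimono_delta C])
    qed
    also have "\<dots> = ennreal (\<Sum>n. a (n + k))"
      using a by (intro suminf_ennreal2) auto
    also have "\<dots> \<le> ennreal e"
      using k1[of k] by (intro ennreal_leI) (auto simp: k_def)
    finally show ?thesis .
  qed
  then show ?thesis
    by (rule hausdorff_measure_zeroI)
qed

subsection \<open>Engel series with prescribed digits\<close>

text \<open>The value of the Engel expansion, with \<open>d n\<close> as digit number n + 1.\<close>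

definition engel_series :: "(nat \<Rightarrow> nat) \<Rightarrow> real" where
  "engel_series d = (\<Sum>k. 1 / (\<Prod>i\<le>k. real (d i)))"

text \<open>Comparison with the geometric series of ratio 1 / d 0, which is the case of constant
  digits.\<close>

lemma engel_series_bounds:
  assumes "mono d" "2 \<le> d 0"
  shows "summable (\<lambda>k. 1 / (\<Prod>i\<le>k. real (d i)))"
    and "0 < engel_series d" and "engel_series d \<le> 1 / (real (d 0) - 1)"
proof -
  have d: "d 0 \<le> d i" for i
    using assms(1) by (simp add: monoD)
  have le: "1 / (\<Prod>i\<le>k. real (d i)) \<le> (1 / real (d 0)) ^ Suc k" for k
  proof -
    have "(\<Prod>i\<le>k. real (d 0)) \<le> (\<Prod>i\<le>k. real (d i))"
      using d by (intro prod_mono) auto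
    moreover have "0 < (\<Prod>i\<le>k. real (d 0))"
      using assms(2) by (intro prod_pos) auto
    ultimately have "1 / (\<Prod>i\<le>k. real (d i)) \<le> 1 / (\<Prod>i\<le>k. real (d 0))"
      by (intro frac_le) auto
    then show ?thesis by (simp add: power_one_over)
  qed
  have pos: "0 < 1 / (\<Prod>i\<le>k. real (d i))" for k
    using d assms(2) by (auto intro!: prod_pos simp: order.strict_trans2[of 0 "d 0"])
  have geo: "(\<lambda>k. (1 / real (d 0)) ^ Suc k) sums (1 / real (d 0) * (1 / (1 - 1 / real (d 0))))"
    unfolding power_Suc using assms(2) by (intro sums_mult geometric_sums) auto
  show sm: "summable (\<lambda>k. 1 / (\<Prod>i\<le>k. real (d i)))"
    using le less_imp_le[OF pos] by (intro summable_comparison_test'[OF sums_summable[OF geo]]) auto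
  show "0 < engel_series d"
    unfolding engel_series_def using pos by (intro suminf_pos sm) auto
  have "engel_series d \<le> (\<Sum>k. (1 / real (d 0)) ^ Suc k)"
    unfolding engel_series_def using le by (intro suminf_le sm sums_summable[OF geo])
  also have "\<dots> = 1 / (real (d 0) - 1)"
    using sums_unique[OF geo] assms(2) by (simp add: field_simps)
  finally show "engel_series d \<le> 1 / (real (d 0) - 1)" .
qed

lemma engel_series_rec:
  assumes "mono d" "2 \<le> d 0"
  shows "engel_series d = (1 + engel_series (\<lambda>i. d (Suc i))) / real (d 0)"
proof -
  have "mono (\<lambda>i. d (Suc i))"
    using assms(1) by (auto simp: mono_def)
  moreover have "2 \<le> d (Suc 0)"
    using assms(2) monoD[OF assms(1), of 0 "Suc 0"] by linarith
  ultimately  have sm: "summable (\<lambda>k. 1 / (\<Prod>i\<le>k. real (d (Suc i))))"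
    using engel_series_bounds(1)[of "\<lambda>i. d (Suc i)"] by simp
  have "engel_series d = 1 / real (d 0) + (\<Sum>k. 1 / (\<Prod>i\<le>Suc k. real (d i)))"
    unfolding engel_series_def by (subst suminf_split_head[OF engel_series_bounds(1)[OF assms]]) simp
  also have "(\<Sum>k. 1 / (\<Prod>i\<le>Suc k. real (d i))) = (\<Sum>k. 1 / real (d 0) * (1 / (\<Prod>i\<le>k. real (d (Suc i)))))"
    by (simp add: prod.atMost_Suc_shift del: prod.atMost_Suc)
  also have "\<dots> = 1 / real (d 0) * engel_series (\<lambda>i. d (Suc i))"
    unfolding engel_series_def by (rule suminf_mult[OF sm])
  finally show ?thesis by (simp add: add_divide_distrib)
qed

lemma strict_mono_shift_nat: "strict_mono (d :: nat \<Rightarrow> nat) \<Longrightarrow> strict_mono (\<lambda>i. d (i + n))"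
  by (auto simp: strict_mono_def)

text \<open>Since d 1 > d 0, the tail y satisfies y \<le> 1 / (d 1 - 1) < 1 / (d 0 - 1), which
  places d 0 / (1 + y) in (d 0 - 1, d 0]. Constant digits would give y = 1 / (d 0 - 1) and a first
  digit one too small; hence strict monotonicity.\<close>

lemma engel_series_digit:
  assumes "strict_mono d" "2 \<le> d 0"
  shows "engel_series d < 1" "\<lceil>1 / engel_series d\<rceil> = int (d 0)"
    "engel_map (engel_series d) = engel_series (\<lambda>i. d (Suc i))"
proof -
  have d: "mono d" "mono (\<lambda>i. d (Suc i))" "d 0 < d 1"
    using assms(1) strict_mono_shift_nat[OF assms(1), of 1] by (auto simp: strict_mono_mono strict_monoD)
  note rec = engel_series_rec[OF d(1) assms(2)]
  let ?y = "engel_series (\<lambda>i. d (Suc i))"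
  have y: "0 < ?y" "?y \<le> 1 / (real (d 1) - 1)"
    using engel_series_bounds(2,3)[OF d(2)] assms(2) d(3) by auto
  have "1 / (real (d 1) - 1) < 1 / (real (d 0) - 1)"
    using d(3) assms(2) by (intro divide_strict_left_mono) auto
  then have "?y < 1 / (real (d 0) - 1)" using y by simp
  then have yd: "?y * (real (d 0) - 1) < 1"
    using assms(2) by (simp add: pos_less_divide_eq)
  have "1 / engel_series d = real (d 0) / (1 + ?y)"
    unfolding rec by simp
  moreover have "real (d 0) / (1 + ?y) \<le> real (d 0)" "real (d 0) - 1 < real (d 0) / (1 + ?y)"
    using y yd assms(2) by (simp_all add: field_simps)
  ultimately show dig: "\<lceil>1 / engel_series d\<rceil> = int (d 0)"
    by (simp add: ceiling_unique)
  have pos: "0 < engel_series d"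
    by (rule engel_series_bounds(2)[OF d(1) assms(2)])
  show "engel_map (engel_series d) = ?y"
    using pos dig rec y(1) assms(2) by (simp add: engel_map_def)
  have "?y < 1"
  proof -
    have "?y * 1 \<le> ?y * (real (d 0) - 1)"
      using y(1) assms(2) by (intro mult_left_mono) auto
    then show ?thesis using yd by linarith
  qed
  then show "engel_series d < 1"
    unfolding rec using assms(2) by simp
qed

lemma engel_iterate_series:
  assumes "strict_mono d" "2 \<le> d 0"
  shows "(engel_map ^^ n) (engel_series d) = engel_series (\<lambda>i. d (i + n))"
proof (induction n)
  case (Suc n)
  have "2 \<le> d (0 + n)"
    using assms strict_mono_mono[OF assms(1)] by (metis le_add1 le_trans monoD)
  then show ?case
    using engel_series_digit(3)[OF strict_mono_shift_nat[OF assms(1)]] by (simp add: Suc)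
qed simp

lemma engel_digit_series:
  assumes "strict_mono d" "2 \<le> d 0"
  shows "engel_indices (engel_series d) = {1..}" "engel_digit (Suc n) (engel_series d) = int (d n)"
proof -
  have d2: "2 \<le> d (0 + n)" for n
    using assms strict_mono_mono[OF assms(1)] by (metis le_add1 le_trans monoD)
  have "(engel_map ^^ n) (engel_series d) \<noteq> 0" for n
    using engel_series_bounds(2)[OF strict_mono_mono[OF strict_mono_shift_nat[OF assms(1), of n]] d2]
    unfolding engel_iterate_series[OF assms] by simp
  then show "engel_indices (engel_series d) = {1..}"
    by (auto simp: engel_indices_def)
  show "engel_digit (Suc n) (engel_series d) = int (d n)"
    using engel_series_digit(2)[OF strict_mono_shift_nat[OF assms(1), of n] d2]
    by (simp add: engel_digit_def engel_iterate_series[OF assms])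
qed

text \<open>The tail of \<open>d\<close> is at most 1 / e 0 and that of \<open>e\<close> at least 1
  / e 1. Even for d 0 = e 0 + 1, where the leading terms leave no gap, the second digit of
  \<open>e\<close> contributes 1 / (e 0 e 1).\<close>

lemma engel_series_separation:
  assumes d: "strict_mono d" "d 0 \<le> M" and e: "strict_mono e" "2 \<le> e 0" "e 1 \<le> M"
    and less: "e 0 < d 0"
  shows "(real (d 0) - real (e 0)) / (real M)\<^sup>2 \<le> engel_series e - engel_series d"
proof -
  have md: "mono d" "mono (\<lambda>i. d (Suc i))" "d 0 < d 1"
    using d(1) strict_mono_shift_nat[OF d(1), of 1] by (auto simp: strict_mono_mono strict_monoD)
  have me: "mono e" "mono (\<lambda>i. e (Suc i))" "mono (\<lambda>i. e (Suc (Suc i)))" "e 0 < e 1" "e 1 < e 2"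
    using e(1) strict_mono_shift_nat[OF e(1), of 1] strict_mono_shift_nat[OF e(1), of 2]
    by (auto simp: strict_mono_mono strict_monoD)
  let ?x = "engel_series (\<lambda>i. d (Suc i))" and ?y = "engel_series (\<lambda>i. e (Suc i))"
  have "?x \<le> 1 / (real (d 1) - 1)"
    using engel_series_bounds(3)[OF md(2)] md(3) e(2) less by simp
  also have "\<dots> \<le> 1 / real (e 0)"
    using less md(3) e(2) by (intro divide_left_mono) auto
  finally have x: "?x \<le> 1 / real (e 0)" .
  have "0 < engel_series (\<lambda>i. e (Suc (Suc i)))"
    using engel_series_bounds(2)[OF me(3)] me(4,5) e(2) by (simp add: numeral_2_eq_2)
  then have y: "1 / real (e 1) \<le> ?y"
    using engel_series_rec[OF me(2)] me(4) e(2) by (simp add: divide_right_mono)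
  have M: "real (d 0) * real (e 0) \<le> (real M)\<^sup>2" "real (e 0) * real (e 1) \<le> (real M)\<^sup>2"
    unfolding power2_eq_square using assms me(4) by (intro mult_mono; simp)+
  have pos: "0 < real (d 0)" "0 < real (e 0)" "0 < real (e 1)" "0 < real M"
    using less e(2) me(4) d(2) by auto
  \<comment> \<open>One unit of the digit difference is split off, to be covered by the second digit
    of \<open>e\<close>.\<close>
  have "(real (d 0) - real (e 0)) / (real M)\<^sup>2
      = (real (d 0) - real (e 0) - 1) / (real M)\<^sup>2 + 1 / (real M)\<^sup>2"
    by (simp flip: add_divide_distrib)
  also have "\<dots> \<le> (real (d 0) - real (e 0) - 1) / (real (d 0) * real (e 0)) + 1 / (real (e 0) * real (e 1))"
    using M pos less by (intro add_mono divide_left_mono) auto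
  also have "\<dots> = (1 + 1 / real (e 1)) / real (e 0) - (1 + 1 / real (e 0)) / real (d 0)"
    using pos by (simp add: field_simps)
  also have "\<dots> \<le> (1 + ?y) / real (e 0) - (1 + ?x) / real (d 0)"
    using x y pos by (intro diff_mono divide_right_mono) auto
  also have "\<dots> = engel_series e - engel_series d"
    using engel_series_rec[OF md(1)] engel_series_rec[OF me(1)] e(2) less by simp
  finally show ?thesis .
qed

text \<open>A shared digit means a shared affine inverse branch, which divides differences by that
  digit.\<close>

lemma engel_series_common_prefix:
  assumes "mono d" "2 \<le> d 0" "mono e" "2 \<le> e 0" "\<And>i. i < n \<Longrightarrow> d i = e i"
  shows "engel_series d - engel_series e
    = (engel_series (\<lambda>i. d (i + n)) - engel_series (\<lambda>i. e (i + n))) / (\<Prod>i<n. real (d i))"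
  using assms(5)
proof (induction n)
  case (Suc n)
  have m: "mono (\<lambda>i. d (i + n))" "mono (\<lambda>i. e (i + n))"
    using assms by (auto simp: mono_def)
  have "2 \<le> d n" "2 \<le> e n"
    using assms monoD[of d 0 n] monoD[of e 0 n] by auto
  then have "engel_series (\<lambda>i. d (i + n)) - engel_series (\<lambda>i. e (i + n))
      = (engel_series (\<lambda>i. d (Suc i + n)) - engel_series (\<lambda>i. e (Suc i + n))) / real (d n)"
    using engel_series_rec[OF m(1)] engel_series_rec[OF m(2)] Suc.prems[of n]
    by (simp flip: diff_divide_distrib)
  then show ?case
    using Suc by simp
qed simp

subsection \<open>Mixed radix expansions\<close>

text \<open>Cantor series: u is the sum over n of \<open>radix_digit m u n\<close> / (m 0 ... m n),
  and the tail is the rescaled remainder after n digits.\<close>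

primrec radix_tail :: "(nat \<Rightarrow> nat) \<Rightarrow> real \<Rightarrow> nat \<Rightarrow> real" where
  "radix_tail m u 0 = u"
| "radix_tail m u (Suc n) = frac (real (m n) * radix_tail m u n)"

definition radix_digit :: "(nat \<Rightarrow> nat) \<Rightarrow> real \<Rightarrow> nat \<Rightarrow> nat" where
  "radix_digit m u n = nat \<lfloor>real (m n) * radix_tail m u n\<rfloor>"

lemma radix_tail_bounds:
  assumes "u \<in> {0..<1}"
  shows "0 \<le> radix_tail m u n" "radix_tail m u n < 1"
  using assms by (induction n) (auto simp: frac_lt_1)

lemma of_nat_radix_digit:
  assumes "u \<in> {0..<1}"
  shows "real (radix_digit m u n) = real (m n) * radix_tail m u n - radix_tail m u (Suc n)"
  using radix_tail_bounds[OF assms] by (simp add: radix_digit_def frac_def)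

lemma radix_digit_less:
  assumes "u \<in> {0..<1}" "0 < m n"
  shows "radix_digit m u n < m n"
proof -
  have "real (m n) * radix_tail m u n < real (m n) * 1"
    using radix_tail_bounds[OF assms(1), of m n] assms(2) by (intro mult_strict_left_mono) auto
  then have "real (radix_digit m u n) < real (m n)"
    using of_nat_radix_digit[OF assms(1), of m n] radix_tail_bounds(1)[OF assms(1), of m "Suc n"] by linarith
  then show ?thesis by simp
qed

lemma radix_common_prefix:
  assumes "u \<in> {0..<1}" "v \<in> {0..<1}" "\<And>n. 0 < m n"
    and "\<And>i. i < n \<Longrightarrow> radix_digit m u i = radix_digit m v i"
  shows "u - v = (radix_tail m u n - radix_tail m v n) / (\<Prod>i<n. real (m i))"
  using assms(4)
proof (induction n)
  case (Suc n)
  have "radix_tail m u (Suc n) - radix_tail m v (Suc n) = real (m n) * (radix_tail m u n - radix_tail m v n)"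
    using of_nat_radix_digit[OF assms(1), of m n] of_nat_radix_digit[OF assms(2), of m n] Suc.prems[of n]
    by (simp add: algebra_simps)
  then show ?case
    using Suc assms(3)[of n] by (simp del: radix_tail.simps)
qed simp

text \<open>The first n digits cancel. At level n the tails contribute at most 1, which the digit
  difference, being at least 1, absorbs at the cost of the factor 2.\<close>

lemma radix_diff_le:
  assumes "u \<in> {0..<1}" "v \<in> {0..<1}" "\<And>n. 0 < m n"
    and "\<And>i. i < n \<Longrightarrow> radix_digit m u i = radix_digit m v i"
    and "radix_digit m u n \<noteq> radix_digit m v n"
  shows "\<bar>u - v\<bar> \<le> 2 * (\<bar>real (radix_digit m u n) - real (radix_digit m v n)\<bar> / real (m n)) / (\<Prod>i<n. real (m i))"
proof -
  let ?k = "\<bar>real (radix_digit m u n) - real (radix_digit m v n)\<bar>"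
  let ?r = "radix_tail m u (Suc n) - radix_tail m v (Suc n)"
  have "real (m n) * (radix_tail m u n - radix_tail m v n)
      = (real (radix_digit m u n) - real (radix_digit m v n)) + ?r"
    unfolding of_nat_radix_digit[OF assms(1)] of_nat_radix_digit[OF assms(2)] by (simp add: right_diff_distrib)
  then have "real (m n) * \<bar>radix_tail m u n - radix_tail m v n\<bar>
      = \<bar>(real (radix_digit m u n) - real (radix_digit m v n)) + ?r\<bar>"
    by (metis abs_mult abs_of_nat)
  also have "\<dots> \<le> ?k + \<bar>?r\<bar>"
    by (rule abs_triangle_ineq)
  also have "\<bar>?r\<bar> \<le> 1"
    using radix_tail_bounds[OF assms(1), of m "Suc n"] radix_tail_bounds[OF assms(2), of m "Suc n"]
    by linarith
  also have "1 \<le> ?k" using assms(5) by linarith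
  finally have "real (m n) * \<bar>radix_tail m u n - radix_tail m v n\<bar> \<le> 2 * ?k"
    by simp
  then have "\<bar>radix_tail m u n - radix_tail m v n\<bar> \<le> 2 * ?k / real (m n)"
    using assms(3)[of n] by (subst pos_le_divide_eq) (simp_all only: of_nat_0_less_iff mult.commute)
  then have "\<bar>radix_tail m u n - radix_tail m v n\<bar> \<le> 2 * (?k / real (m n))"
    by (simp only: times_divide_eq_right)
  then have "\<bar>radix_tail m u n - radix_tail m v n\<bar> / (\<Prod>i<n. real (m i))
      \<le> 2 * (?k / real (m n)) / (\<Prod>i<n. real (m i))"
    by (intro divide_right_mono prod_nonneg) auto
  moreover have "\<bar>u - v\<bar> = \<bar>radix_tail m u n - radix_tail m v n\<bar> / (\<Prod>i<n. real (m i))"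
  proof -
    have "0 \<le> (\<Prod>i<n. real (m i))" by (intro prod_nonneg) auto
    moreover have "u - v = (radix_tail m u n - radix_tail m v n) / (\<Prod>i<n. real (m i))"
      by (rule radix_common_prefix) (use assms in blast)+
    ultimately show ?thesis by (simp only: abs_divide abs_of_nonneg)
  qed
  ultimately show ?thesis by (simp only:)
qed

subsection \<open>Lower bound\<close>

text \<open>Comparison with n^(-c t) from both sides: the series converges exactly for c t > 1. The
  admissible exponents form an open ray whose infimum is not attained.\<close>

lemma convergence_exponent_engel_series:
  assumes "1 < c" "strict_mono d" "2 \<le> d 0"
    and d: "\<And>n. real (n + 2) powr c \<le> real (d n)" "\<And>n. real (d n) \<le> real (n + 3) powr c"
  shows "convergence_exponent (engel_series d) = ennreal (1 / c)"
proof -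
  let ?x = "engel_series d"
  have summable_iff:
    "(\<lambda>n. real_of_int (engel_digit n ?x) powr (- t)) summable_on engel_indices ?x \<longleftrightarrow> 1 / c < t"
    if "0 \<le> t" for t
  proof -
    have "bij_betw Suc UNIV {1..}"
      by (auto simp: bij_betw_def image_iff Suc_le_eq gr0_conv_Suc)
    then have "(\<lambda>n. real_of_int (engel_digit n ?x) powr (- t)) summable_on engel_indices ?x
        \<longleftrightarrow> (\<lambda>n. real_of_int (engel_digit (Suc n) ?x) powr (- t)) summable_on UNIV"
      unfolding engel_digit_series(1)[OF assms(2,3)]
      by (rule summable_on_reindex_bij_betw [symmetric])
    also have "\<dots> \<longleftrightarrow> summable (\<lambda>n. real (d n) powr (- t))"
      by (simp add: engel_digit_series(2)[OF assms(2,3)] summable_on_UNIV_nonneg_real_iff)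
    also have "\<dots> \<longleftrightarrow> 1 / c < t"
    proof
      assume *: "summable (\<lambda>n. real (d n) powr (- t))"
      have "summable (\<lambda>n. real (n + 3) powr (- (c * t)))"
      proof (rule summable_comparison_test'[OF *])
        fix n
        have "0 < real (d n)" using d(1)[of n] by (rule less_le_trans[rotated]) simp
        then have "(real (n + 3) powr c) powr (- t) \<le> real (d n) powr (- t)"
          using d(2)[of n] that by (intro powr_mono2') auto
        then show "norm (real (n + 3) powr (- (c * t))) \<le> real (d n) powr (- t)"
          by (simp add: powr_powr)
      qed
      then have "summable (\<lambda>n. real n powr (- (c * t)))"
        by (subst (asm) summable_iff_shift)
      then show "1 / c < t"
        using assms(1) by (simp add: summable_real_powr_iff field_simps)
    next
      assume "1 / c < t"
      then have "summable (\<lambda>n. real n powr (- (c * t)))"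
        using assms(1) by (simp add: summable_real_powr_iff field_simps)
      then have *: "summable (\<lambda>n. real (n + 2) powr (- (c * t)))"
        by (subst summable_iff_shift)
      show "summable (\<lambda>n. real (d n) powr (- t))"
      proof (rule summable_comparison_test'[OF *])
        fix n
        have "real (d n) powr (- t) \<le> (real (n + 2) powr c) powr (- t)"
          using d(1)[of n] that by (intro powr_mono2') auto
        then show "norm (real (d n) powr (- t)) \<le> real (n + 2) powr (- (c * t))"
          by (simp add: powr_powr)
      qed
    qed
    finally show ?thesis .
  qed
  have set_eq: "{s. 0 \<le> s \<and> (\<lambda>n. real_of_int (engel_digit n ?x) powr (- s)) summable_on engel_indices ?x}
      = {1 / c<..}"
  proof -
    have "0 \<le> t" if "1 / c < t" for t
      using that assms(1) by (rule_tac order.trans[of 0 "1 / c"]) auto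
    with summable_iff show ?thesis by blast
  qed
  show ?thesis
    unfolding convergence_exponent_def set_eq
  proof (rule antisym)
    show "ennreal (1 / c) \<le> (INF s\<in>{1 / c<..}. ennreal s)"
      by (intro INF_greatest ennreal_leI) auto
    show "(INF s\<in>{1 / c<..}. ennreal s) \<le> ennreal (1 / c)"
    proof (rule ennreal_le_epsilon)
      fix e :: real assume "0 < e"
      then have "(INF s\<in>{1 / c<..}. ennreal s) \<le> ennreal (1 / c + e)"
        by (intro INF_lower) auto
      then show "(INF s\<in>{1 / c<..}. ennreal s) \<le> ennreal (1 / c) + ennreal e"
        using assms(1) \<open>0 < e\<close> by (simp add: ennreal_plus)
    qed
  qed
qed

text \<open>The sequence is the ratio of the mixed radix cell size to the \<open>s\<close>-th power of the gap
  between neighbouring cylinders, hence controls the Hoelder constant at level \<open>n\<close>.\<close>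

lemma superexponential_decay:
  fixes c s :: real and m :: "nat \<Rightarrow> nat"
  assumes "1 < c" "0 < s" "c * s < c - 1" and m: "\<And>n. real (n + 2) powr (c - 1) \<le> 2 * real (m n)"
  shows "(\<lambda>n. real (n + 4) powr (2 * c * s) * (\<Prod>i<n. real (i + 3) powr (c * s) / real (m i))) \<longlonglongrightarrow> 0"
    (is "?R \<longlonglongrightarrow> 0")
proof -
  \<comment> \<open>An upper bound for the ratio of consecutive terms, with 1 / m n replaced by 2
    (n+2)^(1-c); it tends to 0 because c s < c - 1.\<close>
  define b where "b n = 2 * (real (n + 5) / real (n + 4)) powr (2 * c * s)
      * ((real (n + 3) / real (n + 2)) powr (c * s) * real (n + 2) powr (c * s - (c - 1)))" for n
  have "b \<longlonglongrightarrow> 2 * 1 powr (2 * c * s) * (1 powr (c * s) * 0)"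
    unfolding b_def
  proof (intro tendsto_intros)
    show "(\<lambda>n. real (n + 5) / real (n + 4)) \<longlonglongrightarrow> 1" "(\<lambda>n. real (n + 3) / real (n + 2)) \<longlonglongrightarrow> 1"
      by real_asymp+
    show "(\<lambda>n. real (n + 2) powr (c * s - (c - 1))) \<longlonglongrightarrow> 0"
    proof (rule tendsto_neg_powr)
      show "filterlim (\<lambda>n. real (n + 2)) at_top sequentially" by real_asymp
    qed (use assms in simp)
  qed auto
  then have "eventually (\<lambda>n. b n < 1 / 2) sequentially"
    by (intro order_tendstoD(2)) auto
  then obtain n0 where n0: "\<And>n. n \<ge> n0 \<Longrightarrow> b n < 1 / 2"
    by (auto simp: eventually_sequentially)
  have "summable ?R"
  proof (rule summable_ratio_test)
    fix n assume "n0 \<le> n"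
    have mn: "0 < real (m n)"
      using m[of n] powr_gt_zero[of "real (n + 2)" "c - 1"] by linarith
    have R: "0 \<le> ?R n" by (intro mult_nonneg_nonneg prod_nonneg) auto
    have "real (n + 5) powr (2 * c * s) * (real (n + 3) powr (c * s) / real (m n)) \<le>
        real (n + 5) powr (2 * c * s) * (real (n + 3) powr (c * s) / (real (n + 2) powr (c - 1) / 2))"
      using m[of n] by (intro mult_left_mono divide_left_mono mult_pos_pos mn) auto
    also have "\<dots> = b n * real (n + 4) powr (2 * c * s)"
      unfolding b_def by (subst (1 2) powr_divide) (auto simp: powr_diff)
    also have "\<dots> \<le> 1 / 2 * real (n + 4) powr (2 * c * s)"
      using n0[OF \<open>n0 \<le> n\<close>] by (intro mult_right_mono) auto
    finally have "real (n + 5) powr (2 * c * s) * (real (n + 3) powr (c * s) / real (m n))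
          * (\<Prod>i<n. real (i + 3) powr (c * s) / real (m i)) \<le>
        1 / 2 * real (n + 4) powr (2 * c * s) * (\<Prod>i<n. real (i + 3) powr (c * s) / real (m i))"
      by (rule mult_right_mono) (auto intro!: prod_nonneg)
    moreover have "?R (Suc n) = real (n + 5) powr (2 * c * s) * (real (n + 3) powr (c * s) / real (m n))
          * (\<Prod>i<n. real (i + 3) powr (c * s) / real (m i))"
      by (simp add: add.commute)
    moreover have "0 \<le> ?R (Suc n)" by (intro mult_nonneg_nonneg prod_nonneg) auto
    ultimately show "norm (?R (Suc n)) \<le> 1 / 2 * norm (?R n)"
      using R by (simp only: real_norm_def abs_of_nonneg mult.assoc)
  qed simp
  then show ?thesis by (rule summable_LIMSEQ_zero)
qed

text \<open>Otherwise the inverse Hoelder bound along \<open>g\<close> would make [0,1) negligible,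
  where \<open>g u\<close> is the Engel series whose digits encode the mixed radix digits of
  u.\<close>

lemma hausdorff_premeasure_convergence_exponent_eq:
  assumes "0 < \<alpha>" "\<alpha> < 1" "0 < s" "s < 1 - \<alpha>"
  shows "hausdorff_premeasure s 1 {x \<in> {0<..<1}. convergence_exponent x = ennreal \<alpha>} \<noteq> 0"
proof
  let ?A = "{x \<in> {0<..<1}. convergence_exponent x = ennreal \<alpha>}"
  assume zero: "hausdorff_premeasure s 1 ?A = 0"
  define c where "c = 1 / \<alpha>"
  have c: "1 < c" "1 / c = \<alpha>" using assms by (auto simp: c_def)
  have cs: "c * s < c - 1"
    using assms by (simp add: c_def field_simps)
  \<comment> \<open>The number of choices at level n. As (n+2)^c + (n+2)^(c-1) \<le> (n+3)^c, the
    digits of level n stay below those of level n + 1. The shift by 2 makes the first digit at least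
    2.\<close>
  define m where "m n = nat \<lfloor>real (n + 2) powr (c - 1)\<rfloor>" for n
  define d where "d u n = nat \<lceil>real (n + 2) powr c\<rceil> + radix_digit m u n" for u n
  have m1: "1 \<le> real (n + 2) powr (c - 1)" for n
    using c by (intro ge_one_powr_ge_zero) auto
  have m_pos: "0 < m n" for n
    using m1[of n] by (simp add: m_def)
  have m_le: "real (m n) \<le> real (n + 2) powr (c - 1)" for n
    using m1[of n] by (simp add: m_def)
  have m_ge: "real (n + 2) powr (c - 1) \<le> 2 * real (m n)" for n
    using m1[of n] m_pos[of n] unfolding m_def by linarith
  have d_ge: "real (n + 2) powr c \<le> real (d u n)" for u n
    unfolding d_def by linarith
  have d_less: "real (d u n) < real (n + 3) powr c" if "u \<in> {0..<1}" for u n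
  proof -
    have d_eq: "real (d u n) = real (nat \<lceil>real (n + 2) powr c\<rceil>) + real (radix_digit m u n)"
      by (simp add: d_def)
    have "real (nat \<lceil>real (n + 2) powr c\<rceil>) < real (n + 2) powr c + 1"
      using powr_ge_zero[of "real (n + 2)" c] by linarith
    moreover have "radix_digit m u n + 1 \<le> m n"
      using radix_digit_less[of u m n, OF that m_pos] by (simp add: Suc_le_eq)
    then have "real (radix_digit m u n) + 1 \<le> real (m n)"
      by linarith
    ultimately have "real (d u n) < real (n + 2) powr c + real (n + 2) powr (c - 1)"
      using m_le[of n] unfolding d_eq by linarith
    also have "real (n + 2) powr c = real (n + 2) * real (n + 2) powr (c - 1)"
      by (simp add: powr_diff)
    also have "\<dots> + real (n + 2) powr (c - 1) = real (n + 3) * real (n + 2) powr (c - 1)"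
      by (simp add: algebra_simps)
    also have "\<dots> \<le> real (n + 3) * real (n + 3) powr (c - 1)"
      using c by (intro mult_left_mono powr_mono2) auto
    also have "\<dots> = real (n + 3) powr c"
      by (simp add: powr_diff)
    finally show ?thesis .
  qed
  have d_sm: "strict_mono (d u)" if "u \<in> {0..<1}" for u
    unfolding strict_mono_Suc_iff
  proof
    fix n
    have "real (d u n) < real (d u (Suc n))"
      using d_less[OF that, of n] d_ge[of "Suc n" u] by (simp add: add.commute)
    then show "d u n < d u (Suc n)" by simp
  qed
  have d0: "2 \<le> d u 0" for u
  proof -
    have "(2::real) powr 1 \<le> 2 powr c" using c by (intro powr_mono) auto
    then show ?thesis using d_ge[of 0 u] by simp
  qed
  define g where "g u = engel_series (d u)" for u
  \<comment> \<open>Up to a factor 2, the Hoelder constant for points that first differ at level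
    n.\<close>
  define R where "R n = real (n + 4) powr (2 * c * s) * (\<Prod>i<n. real (i + 3) powr (c * s) / real (m i))" for n
  have R0: "R \<longlonglongrightarrow> 0"
    unfolding R_def by (rule superexponential_decay) (use c assms cs m_ge in auto)
  then obtain B where B: "\<And>n. R n \<le> B"
    by (metis Bseq_def abs_le_D1 convergentI convergent_imp_Bseq real_norm_def)
  \<comment> \<open>The powers in \<open>R n\<close> are at least 1, so \<open>R n\<close> also
    dominates the size of the radix cells.\<close>
  have inv_prod_le: "1 / (\<Prod>i<n. real (m i)) \<le> R n" for n
  proof -
    have "1 * (\<Prod>i<n. 1 / real (m i)) \<le> R n"
      unfolding R_def using c assms m_pos
      by (intro mult_mono prod_mono prod_nonneg conjI divide_right_mono ge_one_powr_ge_zero) auto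
    then show ?thesis by (simp add: prod_dividef)
  qed
  have "negligible {0..<1::real}"
  proof (rule negligible_if_inverse_Hoelder[OF \<open>0 < s\<close> zero, of g _ "2 * B"])
    show "g ` {0..<1} \<subseteq> ?A"
    proof safe
      fix u :: real assume u: "u \<in> {0..<1}"
      show "g u \<in> {0<..<1}"
        using engel_series_bounds(2)[OF strict_mono_mono[OF d_sm[OF u]] d0]
          engel_series_digit(1)[OF d_sm[OF u] d0] by (simp add: g_def)
      show "convergence_exponent (g u) = ennreal \<alpha>"
        unfolding g_def c(2) [symmetric]
        using d_ge d_less[OF u] by (intro convergence_exponent_engel_series c(1) d_sm u d0) (auto intro: less_imp_le)
    qed
  next
    fix u v :: real assume u: "u \<in> {0..<1}" and v: "v \<in> {0..<1}"
    show "\<bar>u - v\<bar> \<le> 2 * B * dist (g u) (g v) powr s"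
    proof (cases "\<exists>n. radix_digit m u n \<noteq> radix_digit m v n")
      \<comment> \<open>The points share radix cells of every level, whose sizes tend to 0; hence u
        = v.\<close>
      case False
      have "\<bar>u - v\<bar> \<le> R n" for n
      proof -
        have "\<bar>u - v\<bar> = \<bar>radix_tail m u n - radix_tail m v n\<bar> / (\<Prod>i<n. real (m i))"
          using radix_common_prefix[of u v m n, OF u v m_pos] False by (simp add: abs_divide abs_prod)
        also have "\<dots> \<le> 1 / (\<Prod>i<n. real (m i))"
          using radix_tail_bounds[OF u, of m n] radix_tail_bounds[OF v, of m n]
          by (intro divide_right_mono prod_nonneg) auto
        finally show ?thesis using inv_prod_le[of n] by linarith
      qed
      then have "\<bar>u - v\<bar> \<le> 0"
        by (intro LIMSEQ_le_const[OF R0]) auto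
      then show ?thesis by simp
    next
      case True
      define n where "n = (LEAST n. radix_digit m u n \<noteq> radix_digit m v n)"
      have ne: "radix_digit m u n \<noteq> radix_digit m v n"
        unfolding n_def using True by (rule LeastI_ex)
      have eq: "radix_digit m u i = radix_digit m v i" if "i < n" for i
        using not_less_Least that unfolding n_def by blast
      have deq: "d u i = d v i" if "i < n" for i
        using eq[OF that] by (simp add: d_def)
      define k where "k = \<bar>real (radix_digit m u n) - real (radix_digit m v n)\<bar>"
      have k_le: "k \<le> real (m n)"
        using radix_digit_less[of u m n, OF u m_pos] radix_digit_less[of v m n, OF v m_pos]
        unfolding k_def by linarith
      \<comment> \<open>A bound for digits n and n + 1, the two that enter the separation
        estimate.\<close>
      define M where "M = nat \<lfloor>real (n + 4) powr c\<rfloor>"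
      have M: "d w n \<le> M" "d w (Suc n) \<le> M" if "w \<in> {0..<1}" for w
      proof -
        have "real (d w (Suc n)) \<le> real (n + 4) powr c"
          using d_less[OF that, of "Suc n"] by (simp add: add.commute)
        then show "d w (Suc n) \<le> M" unfolding M_def by (simp add: le_nat_floor)
        then show "d w n \<le> M"
          using strict_monoD[OF d_sm[OF that], of n "Suc n"] by simp
      qed
      have sep: "k / (real M)\<^sup>2 \<le> \<bar>engel_series (\<lambda>i. d u (i + n)) - engel_series (\<lambda>i. d v (i + n))\<bar>"
      proof -
        have d2: "2 \<le> d w n" if "w \<in> {0..<1}" for w
          using d0[of w] monoD[OF strict_mono_mono[OF d_sm[OF that]], of 0 n] by linarith
        \<comment> \<open>Stated for generic points, to be applied in either order: the larger digit
          belongs to the smaller series.\<close>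
        have sep: "\<bar>real (d w n) - real (d w' n)\<bar> / (real M)\<^sup>2
            \<le> \<bar>engel_series (\<lambda>i. d w (i + n)) - engel_series (\<lambda>i. d w' (i + n))\<bar>"
          if w: "w \<in> {0..<1}" "w' \<in> {0..<1}" "d w' n < d w n" for w w'
          using engel_series_separation[of "\<lambda>i. d w (i + n)" M "\<lambda>i. d w' (i + n)"]
            strict_mono_shift_nat[OF d_sm] M w d2[OF w(2)]
          by (simp add: abs_minus_commute)
        have "k = \<bar>real (d u n) - real (d v n)\<bar>"
          by (simp add: k_def d_def)
        moreover have "d u n < d v n \<or> d v n < d u n"
          using ne by (auto simp: d_def)
        ultimately show ?thesis
          using sep[OF u v] sep[OF v u] by (metis abs_minus_commute)
      qed
      define D where "D = (\<Prod>i<n. real (d u i))"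
      define Q where "Q = (\<Prod>i<n. real (i + 3) powr c)"
      have D: "0 < D" "D \<le> Q"
      proof -
        have "0 < real (d u i)" for i
          using d_ge[of i u] powr_gt_zero[of "real (i + 2)" c] by linarith
        then show "0 < D" unfolding D_def by (intro prod_pos) auto
        show "D \<le> Q" unfolding D_def Q_def
          using less_imp_le[OF d_less[OF u]] by (intro prod_mono) auto
      qed
      \<comment> \<open>\<open>M\<close> and \<open>D\<close> are replaced by bounds depending on n
        alone, so that the constant is uniform in u and v.\<close>
      have "k / ((real (n + 4) powr c)\<^sup>2 * Q) \<le> k / ((real M)\<^sup>2 * D)"
      proof -
        have "real M \<le> real (n + 4) powr c" unfolding M_def by simp
        moreover have "2 \<le> real M"
          using M(1)[OF u] d0[of u] monoD[OF strict_mono_mono[OF d_sm[OF u]], of 0 n] by linarith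
        ultimately show ?thesis
          using D by (intro divide_left_mono mult_mono power_mono mult_pos_pos) (auto simp: k_def)
      qed
      also have "\<dots> \<le> dist (g u) (g v)"
      proof -
        have "dist (g u) (g v) = \<bar>engel_series (\<lambda>i. d u (i + n)) - engel_series (\<lambda>i. d v (i + n))\<bar> / D"
          using engel_series_common_prefix[OF strict_mono_mono[OF d_sm[OF u]] d0 strict_mono_mono[OF d_sm[OF v]] d0 deq]
            D(1) by (simp add: g_def dist_real_def D_def)
        then show ?thesis
          using divide_right_mono[OF sep, of D] D(1) by simp
      qed
      finally have "(k / ((real (n + 4) powr c)\<^sup>2 * Q)) powr s \<le> dist (g u) (g v) powr s"
        using D assms by (intro powr_mono2) (auto simp: k_def)
      moreover have "(k / ((real (n + 4) powr c)\<^sup>2 * Q)) powr s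
          = k powr s / (real (n + 4) powr (2 * c * s) * Q powr s)"
      proof -
        have "(real (n + 4) powr c)\<^sup>2 = real (n + 4) powr (2 * c)"
          by (simp add: power2_eq_square flip: powr_add)
        then show ?thesis
          using D by (simp add: powr_divide powr_mult powr_powr k_def)
      qed
      ultimately have ks: "k powr s \<le> real (n + 4) powr (2 * c * s) * Q powr s * dist (g u) (g v) powr s"
        using D by (simp add: pos_divide_le_eq mult.commute)
      have Qs: "Q powr s = (\<Prod>i<n. real (i + 3) powr (c * s))"
        unfolding Q_def by (simp add: prod_powr_distrib powr_powr)
      have prod_m: "0 < (\<Prod>i<n. real (m i))"
        using m_pos by (intro prod_pos) auto
      \<comment> \<open>The quotient lies in [0,1], so the power s < 1 does not decrease it;
        dropping m n \<ge> 1 then leaves k^s, the factor found in the distance bound.\<close>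
      have "k / real (m n) \<le> (k / real (m n)) powr s"
      proof -
        have "0 \<le> k / real (m n)" "k / real (m n) \<le> 1"
          using k_le m_pos[of n] by (auto simp: k_def)
        then show ?thesis
          using powr_mono'[of s 1 "k / real (m n)"] assms by (simp add: k_def)
      qed
      also have "\<dots> \<le> k powr s"
        using m_pos[of n] assms by (intro powr_mono2) (auto simp: k_def divide_le_eq mult_le_cancel_left1)
      finally have km: "k / real (m n) \<le> k powr s" .
      have "\<bar>u - v\<bar> \<le> 2 * (k / real (m n)) / (\<Prod>i<n. real (m i))"
        unfolding k_def by (rule radix_diff_le[of u v m n, OF u v m_pos eq ne])
      also have "\<dots> \<le> 2 * (real (n + 4) powr (2 * c * s) * Q powr s * dist (g u) (g v) powr s) / (\<Prod>i<n. real (m i))"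
        using km ks prod_m by (intro divide_right_mono) auto
      also have "\<dots> = 2 * R n * dist (g u) (g v) powr s"
        by (simp add: R_def Qs prod_dividef)
      also have "\<dots> \<le> 2 * B * dist (g u) (g v) powr s"
        using B[of n] by (intro mult_right_mono) auto
      finally show ?thesis .
    qed
  qed
  then show False
    using negligible_subset[of "{0..<1::real}" "{0<..<1}"] open_not_negligible[of "{0<..<1::real}"]
    by (simp add: greaterThanLessThan_subseteq_atLeastLessThan_iff)
qed

section \<open>Exponent zero, and nullity above dimension one\<close>

lemma negligible_if_premeasure_zero:
  fixes A :: "real set"
  assumes "0 < s" "s \<le> 1" "hausdorff_premeasure s 1 A = 0" "A \<subseteq> {0<..<1}"
  shows "negligible A"
proof (rule negligible_if_inverse_Hoelder[OF assms(1,3), of id _ 1])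
  fix u v assume "u \<in> A" "v \<in> A"
  then have "0 < u" "u < 1" "0 < v" "v < 1" using assms(4) by auto
  \<comment> \<open>At distances up to 1 the identity satisfies the inverse Hoelder bound of every
    order s \<le> 1.\<close>
  then have "\<bar>u - v\<bar> \<le> 1" by linarith
  then show "\<bar>u - v\<bar> \<le> 1 * dist (id u) (id v) powr s"
    using powr_mono'[of s 1 "\<bar>u - v\<bar>"] assms by (simp add: dist_real_def)
qed simp

text \<open>The points of positive exponent form the countable union of the \<open>?E k\<close>,
  each null by the upper bound in some dimension below 1 and hence negligible.\<close>

lemma not_negligible_convergence_exponent_zero:
  "\<not> negligible {x \<in> {0<..<1}. convergence_exponent x = 0}"
proof
  let ?E = "\<lambda>k. {x \<in> {0<..<1}. convergence_exponent x \<ge> ennreal (1 / real (k + 2))}"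
  assume "negligible {x \<in> {0<..<1}. convergence_exponent x = 0}"
  moreover have "negligible (?E k)" for k
  proof -
    define \<alpha> where "\<alpha> = 1 / real (k + 2)"
    have \<alpha>: "0 < \<alpha>" "\<alpha> \<le> 1" by (auto simp: \<alpha>_def)
    have "hausdorff_measure (1 - \<alpha> / 2) (?E k) = 0"
      unfolding \<alpha>_def [symmetric] using \<alpha> by (intro hausdorff_measure_convergence_exponent_ge) auto
    then have "hausdorff_premeasure (1 - \<alpha> / 2) 1 (?E k) = 0"
      using hausdorff_premeasure_le_measure[of 1 "1 - \<alpha> / 2" "?E k"] by simp
    then show ?thesis
      using \<alpha> by (intro negligible_if_premeasure_zero[of "1 - \<alpha> / 2"]) auto
  qed
  ultimately have "negligible ({x \<in> {0<..<1}. convergence_exponent x = 0} \<union> (\<Union>k. ?E k))"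
    by (intro negligible_Un negligible_countable_Union) auto
  moreover have "{0<..<1} \<subseteq> {x \<in> {0<..<1}. convergence_exponent x = 0} \<union> (\<Union>k. ?E k)"
  proof
    fix x :: real assume x: "x \<in> {0<..<1}"
    have "\<exists>k. ennreal (1 / real (k + 2)) \<le> convergence_exponent x" if "convergence_exponent x \<noteq> 0"
    proof (cases "convergence_exponent x")
      case (real r)
      then have "0 < r" using that by (cases "r = 0") auto
      then obtain k where "1 / real (Suc k) < r" using nat_approx_posE by blast
      moreover have "1 / real (k + 2) \<le> 1 / real (Suc k)" by (intro frac_le) auto
      ultimately show ?thesis using real by (intro exI[of _ k]) (auto intro!: ennreal_leI)
    qed simp
    then show "x \<in> {x \<in> {0<..<1}. convergence_exponent x = 0} \<union> (\<Union>k. ?E k)"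
      using x by blast
  qed
  ultimately have "negligible {0<..<1::real}"
    using negligible_subset by blast
  then show False
    using open_not_negligible[of "{0<..<1::real}"] by simp
qed

text \<open>Repeated bisection: each halving multiplies the bound by r = 2 * 2^(-s) < 1.\<close>

lemma hausdorff_measure_unit_interval:
  assumes "1 < s" "A \<subseteq> {0..1::real}"
  shows "hausdorff_measure s A = 0"
proof -
  define r where "r = 2 * (1/2 :: real) powr s"
  have "(1/2 :: real) powr s < (1/2) powr 1"
    using assms by (intro powr_less_mono') auto
  then have r: "0 \<le> r" "r < 1" by (auto simp: r_def)
  have le: "hausdorff_premeasure s ((1/2) ^ n) {0..1::real} \<le> ennreal (r ^ n)" for n
  proof (induction n)
    case 0
    then show ?case using assms hausdorff_premeasure_unit_interval_le[of s] by simp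
  next
    case (Suc n)
    let ?f = "\<lambda>x. x / 2 :: real" and ?g = "\<lambda>x. (1 + x) / 2 :: real"
    have sub: "{0..1} \<subseteq> ?f ` {0..1} \<union> ?g ` {0..1}"
    proof
      fix x :: real assume "x \<in> {0..1}"
      then have "2 * x \<in> {0..1} \<or> 2 * x - 1 \<in> {0..1}" by auto
      moreover have "x = ?f (2 * x)" "x = ?g (2 * x - 1)" by auto
      ultimately show "x \<in> ?f ` {0..1} \<union> ?g ` {0..1}" by blast
    qed
    have img: "hausdorff_premeasure s ((1/2) ^ Suc n) (h ` {0..1})
        \<le> ennreal ((1/2) powr s) * ennreal (r ^ n)"
      if "\<And>x y. dist (h x) (h y) \<le> 1/2 * dist x y" for h :: "real \<Rightarrow> real"
      using that assms
      by (intro order_trans[OF hausdorff_premeasure_Lipschitz_image_le[where c = "1/2" and \<delta> = "(1/2) ^ n"]]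
          mult_left_mono Suc.IH) auto
    have "hausdorff_premeasure s ((1/2) ^ Suc n) {0..1::real}
        \<le> hausdorff_premeasure s ((1/2) ^ Suc n) (?f ` {0..1}) + hausdorff_premeasure s ((1/2) ^ Suc n) (?g ` {0..1})"
      by (intro order_trans[OF hausdorff_premeasure_mono[OF sub]] hausdorff_premeasure_Un_le) auto
    also have "\<dots> \<le> ennreal ((1/2) powr s) * ennreal (r ^ n) + ennreal ((1/2) powr s) * ennreal (r ^ n)"
      by (intro add_mono img) (simp_all add: dist_real_def flip: diff_divide_distrib)
    also have "\<dots> = ennreal (r ^ Suc n)"
      using r by (subst ennreal_mult [symmetric] ennreal_plus [symmetric]; simp add: r_def)+
    finally show ?case .
  qed
  have "hausdorff_premeasure s \<delta> A \<le> ennreal e" if "0 < \<delta>" "0 < e" for \<delta> e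
  proof -
    have "eventually (\<lambda>n. (1/2) ^ n < \<delta>) sequentially" "eventually (\<lambda>n. r ^ n < e) sequentially"
      using that r by (intro order_tendstoD(2)[OF LIMSEQ_realpow_zero]; simp)+
    then have "eventually (\<lambda>n. (1/2) ^ n < \<delta> \<and> r ^ n < e) sequentially"
      by (rule eventually_conj)
    then obtain n where n: "(1/2) ^ n < \<delta>" "r ^ n < e"
      using eventually_happens'[OF sequentially_bot] by blast
    have "hausdorff_premeasure s \<delta> A \<le> hausdorff_premeasure s \<delta> {0..1::real}"
      by (rule hausdorff_premeasure_mono[OF assms(2)])
    also have "\<dots> \<le> hausdorff_premeasure s ((1/2) ^ n) {0..1::real}"
      using n by (intro hausdorff_premeasure_antimono_delta) simp
    also note le
    also have "ennreal (r ^ n) \<le> ennreal e"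
      using n by (intro ennreal_leI) auto
    finally show ?thesis .
  qed
  then show ?thesis
    by (rule hausdorff_measure_zeroI)
qed

theorem theorem4p1:
  fixes \<alpha> :: ennreal
  shows "hausdorff_dim {x \<in> {0<..<1}. convergence_exponent x = \<alpha>}
           = hausdorff_dim {x \<in> {0<..<1}. convergence_exponent x \<ge> \<alpha>}
       \<and> hausdorff_dim {x \<in> {0<..<1}. convergence_exponent x \<ge> \<alpha>}
           = (if \<alpha> \<le> 1 then 1 - \<alpha> else 0)"
proof -
  let ?eq = "\<lambda>\<alpha>. hausdorff_dim {x \<in> {0<..<1}. convergence_exponent x = \<alpha>}"
    and ?ge = "\<lambda>\<alpha>. hausdorff_dim {x \<in> {0<..<1}. convergence_exponent x \<ge> \<alpha>}"
  have eq_le_ge: "?eq \<alpha> \<le> ?ge \<alpha>"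
    by (rule hausdorff_dim_mono) auto
  \<comment> \<open>Nullity is known for exponents in (1 - a, 1), a window of length a.\<close>
  have upper: "?ge (ennreal a) \<le> ennreal (1 - a)" if "0 < a" "a \<le> 1" for a
    using that by (intro hausdorff_dim_leI[where e = a] hausdorff_measure_convergence_exponent_ge) auto
  consider "\<alpha> = 0" | a where "\<alpha> = ennreal a" "0 < a" "a < 1" | "1 \<le> \<alpha>"
  proof (cases \<alpha>)
    case (real a)
    then show ?thesis
      using that by (cases "a = 0"; cases "a < 1") (auto simp: not_less)
  qed (use that in auto)
  \<comment> \<open>A lower bound for the smaller set and the same upper bound for the larger one
    force both equalities.\<close>
  then have bounds: "(if \<alpha> \<le> 1 then 1 - \<alpha> else 0) \<le> ?eq \<alpha> \<and> ?ge \<alpha> \<le> (if \<alpha> \<le> 1 then 1 - \<alpha> else 0)"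
  proof cases
    case 1
    have "ennreal 1 \<le> ?eq 0"
    proof (rule hausdorff_dim_geI)
      fix s :: real assume "0 < s" "s < 1"
      then have "negligible {x \<in> {0<..<1}. convergence_exponent x = 0}"
        if "hausdorff_premeasure s 1 {x \<in> {0<..<1}. convergence_exponent x = 0} = 0"
        using that by (intro negligible_if_premeasure_zero[of s]) auto
      then show "hausdorff_premeasure s 1 {x \<in> {0<..<1}. convergence_exponent x = 0} \<noteq> 0"
        using not_negligible_convergence_exponent_zero by blast
    qed
    moreover have "?ge 0 \<le> ennreal 1"
      by (rule hausdorff_dim_leI[where e = 1]) (auto intro!: hausdorff_measure_unit_interval)
    ultimately show ?thesis using 1 by simp
  next
    case (2 a)
    have "ennreal (1 - a) \<le> ?eq (ennreal a)"
      using 2 by (intro hausdorff_dim_geI hausdorff_premeasure_convergence_exponent_eq) auto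
    moreover have "1 - ennreal a = ennreal (1 - a)"
      using 2 by (simp add: ennreal_minus flip: ennreal_1)
    ultimately show ?thesis
      using 2 upper[of a] by simp
  next
    case 3
    \<comment> \<open>All \<alpha> \<ge> 1, including \<infinity>, reduce to \<alpha> = 1, where the
      upper bound is already 0.\<close>
    have "?ge \<alpha> \<le> ?ge 1"
      using 3 by (intro hausdorff_dim_mono) (auto intro: order_trans)
    also have "\<dots> \<le> 0"
      using upper[of 1] by simp
    finally show ?thesis
      using 3 by (auto simp: antisym)
  qed
  have "a = b \<and> b = c" if "c \<le> a \<and> b \<le> c" "a \<le> b" for a b c :: ennreal
    using that by auto
  from this[OF bounds eq_le_ge] show ?thesis .
qed

end
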